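(* Consider the network, queues, and dynamic control algorithm for imperfect cross-channel CSI (with parameter $V>0$ and tolerable privacy outage probabilities $\gamma_j$) described in the context. If $R_j(k)<\infty$ for all $j,k$, then there are constants $B',\epsilon_1',\epsilon_2'>0$ such that the dynamic control algorithm satisfies $$\liminf_{N_2\to\infty}\frac1{N_2}\sum_{k=0}^{N_2-1}\sum_{j=1}^n\mathbb E\left[g_j^p(k)+g_j^o(k)\right]\ge {g'}^*-\frac{B'}V,$$ $$\limsup_{N_2\to\infty}\frac1{N_2}\sum_{k=0}^{N_2-1}\sum_{j=1}^n\mathbb E\left[Q_j^p(k)\right]\le\frac{B'+V(\bar g'-{g'}^* )}{\epsilon_2'},$$ $$\limsup_{N_2\to\infty}\frac1{N_2}\sum_{k=0}^{N_2-1}\sum_{j=1}^n\mathbb E\left[Q_j^o(k)\right]\le\frac{B'+V(\bar g'-{g'}^* )}{\epsilon_1'},$$ where ${g'}^*$ is the optimal value of the problem of maximizing $\sum_{j=1}^n\left(\mathbb E[g_j^p(k)]+\mathbb E[g_j^o(k)]\right)$ subject to $(\lambda_j^o,\lambda_j^p)_j\in\Lambda$ and $p_j^{\text{out}}(\rho_j(k))=\gamma_j$, and $\bar g'$ is the maximum possible aggregate utility.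
   Context: Network. $n$ nodes share an uplink to a base station; time is divided into blocks $k=0,1,2,\dots$. Node $j$ has uplink rate $R_j(k)\ge0$, known at each block, and cross-channel rates $R_{ji}(k)\ge0$, $i\ne j$, of which only estimates $\hat R_{ji}(k)$ (with the a posteriori distribution of $R_{ji}(k)$ given the estimates) are available; channel states and estimates are i.i.d. over blocks. Node $j$ uses a rate margin $\rho_j(k)$ for private encoding. A privacy outage occurs in block $k$ if $\rho_j(k)<\max_{i\ne j}R_{ji}(k)$; its probability is $$p_j^{\text{out}}(\rho_j(k))=\mathbb P\left(\max_{i\neq j}R_{ji}(k)>\rho_j(k)\,\middle|\,\{\hat R_{ji}(k),i\ne j\}\right).$$ The tolerable outage probability of node $j$ is $\gamma_j\in(0,1)$. A privately encoded message in outage is counted as an open message. In each block at most one node transmits, in one of two modes: $\mathcal I_j^p(k)=1$ means node $j$ sends jointly encoded private and open traffic, $\mathcal I_j^o(k)=1$ means node $j$ sends only open traffic; the indicators are in $\{0,1\}$ with $\sum_j(\mathcal I_j^p(k)+\mathcal I_j^o(k))\le1$. Service rates are $$R_j^p(k)=\mathcal I_j^p(k)\left[R_j(k)-\rho_j(k)\right]^+,\quad R_j^o(k)=\mathcal I_j^o(k)R_j(k)+\mathcal I_j^p(k)\left(R_j(k)-R_j^p(k)\right),$$ with $[x]^+=\max\{0,x\}$. Queues. Every node has infinitely backlogged transport-layer data; it injects $A_j^p(k)\ge0$ private and $A_j^o(k)\ge0$ open bits into its queues in block $k$, and $$Q_j^p(k+1)=[Q_j^p(k)-R_j^p(k)]^++A_j^p(k),\qquad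 Q_j^o(k+1)=[Q_j^o(k)-R_j^o(k)]^++A_j^o(k).$$ Service rates and injected amounts are bounded by finite constants. $\lambda_j^p,\lambda_j^o$ are the long-term average rates of $A_j^p(k),A_j^o(k)$. $\Lambda$ is the achievable rate region supported by the network; rate vectors in $\Lambda$ are understood to be strictly interior, i.e. for such a vector there is a stationary, queue-independent scheduling policy whose mean service rates exceed the arrival rates by a positive margin. Utilities. $U_j^p,U_j^o$ are concave non-decreasing functions with $U_j^p(0)=U_j^o(0)=0$; the utility of private transmission exceeds that of open transmission at the same rate. The expected utilities, accounting for outages, are $$\mathbb E[g_j^p(k)]=(1-\gamma_j)\mathbb E[U_j^p(A_j^p(k))],\quad \mathbb E[g_j^o(k)]=\gamma_j\mathbb E[U_j^o(A_j^p(k)+A_j^o(k))]+(1-\gamma_j)\mathbb E[U_j^o(A_j^o(k))].$$ Dynamic control algorithm, with parameter $V>0$ ($B',\epsilon_1',\epsilon_2'$ do not depend on $V$). In each block $k$: (1) Flow control: each node $j$ injects $$(A_j^p(k),A_j^o(k))=\operatorname{argmax}_{A^p,A^o}\;V\left[U_j^p(A^p)(1-\gamma_j)+U_j^o(A^o)(1-\gamma_j)+U_j^o(A^o+A^p)\gamma_j\right]-Q_j^p(k)A^p-Q_j^o(k)A^o$$ (over the allowed bounded injections). (2) Scheduling: with $\rho_j(k)=(p_j^{\text{out}})^{-1}(\gamma_j)$, i.e. $p_j^{\text{out}}(\rho_j(k))=\gamma_j$ (assumed solvable), choose the node $j$ and its mode $(\mathcal I_j^p(k),\mathcal I_j^o(k))$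 maximizing $Q_j^p(k)R_j^p(k)+Q_j^o(k)R_j^o(k)$, and serve at the rates above.
   Formalization: The formal theorem additionally assumes that the optimal value g'* is attained by feasible injections or is strictly below the maximum possible utility; if g'* equals that maximum but is unattained (critical load), queue bounds with constants independent of V can fail. *)

theory Defs
  imports "HOL-Probability.Probability"
begin

text \<open>
  Nodes are the elements of a finite type. \<open>uplink N k \<omega> $ j\<close> is the uplink rate of node \<open>j\<close> in block
  \<open>k\<close>; \<open>cross N k \<omega> $ j $ i\<close> and \<open>estim N k \<omega> $ j $ i\<close> are the cross-channel rate from \<open>j\<close> to
  \<open>i\<close> and its estimate. Diagonal entries of the two matrices carry no meaning and are never used
  (they may be taken to be 0).
  \<open>posterior N j e\<close> is the conditional law of the rates \<open>(R\<^sub>j\<^sub>i)\<close>, \<open>i \<noteq> j\<close>, given that the estimates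
  of these rates take the value \<open>e\<close>.
\<close>

record ('w, 'n) net =
  sample_space :: "'w measure"
  uplink :: "nat \<Rightarrow> 'w \<Rightarrow> real ^ 'n"
  cross :: "nat \<Rightarrow> 'w \<Rightarrow> real ^ 'n ^ 'n"
  estim :: "nat \<Rightarrow> 'w \<Rightarrow> real ^ 'n ^ 'n"
  posterior :: "'n \<Rightarrow> ('n \<Rightarrow> real) \<Rightarrow> ('n \<Rightarrow> real) measure"
  tolerance :: "'n \<Rightarrow> real"
  util_p :: "'n \<Rightarrow> real \<Rightarrow> real"
  util_o :: "'n \<Rightarrow> real \<Rightarrow> real"
  inj_max_p :: "'n \<Rightarrow> real"
  inj_max_o :: "'n \<Rightarrow> real"

definition row_space :: "'n \<Rightarrow> ('n \<Rightarrow> real) measure" where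
  "row_space j = PiM (- {j}) (\<lambda>_. borel)"

definition off_diag_row :: "'n::finite \<Rightarrow> real ^ 'n ^ 'n \<Rightarrow> 'n \<Rightarrow> real" where
  "off_diag_row j A = (\<lambda>i\<in>- {j}. A $ j $ i)"

definition channel_state ::
    "('w, 'n::finite) net \<Rightarrow> nat \<Rightarrow> 'w \<Rightarrow> (real ^ 'n) \<times> (real ^ 'n ^ 'n) \<times> (real ^ 'n ^ 'n)" where
  "channel_state N k \<omega> = (uplink N k \<omega>, cross N k \<omega>, estim N k \<omega>)"

text \<open>The part of the channel state that the controller knows.\<close>

definition observation :: "('w, 'n::finite) net \<Rightarrow> nat \<Rightarrow> 'w \<Rightarrow> (real ^ 'n) \<times> (real ^ 'n ^ 'n)" where
  "observation N k \<omega> = (uplink N k \<omega>, estim N k \<omega>)"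


definition p_out :: "('w, 'n::finite) net \<Rightarrow> 'n \<Rightarrow> ('n \<Rightarrow> real) \<Rightarrow> real \<Rightarrow> real" where
  "p_out N j e \<rho> =
     measure (posterior N j e) {r \<in> space (posterior N j e). Max (r ` (- {j})) > \<rho>}"

text \<open>
  The inverse of the outage probability at the tolerated level. Outage probabilities are
  non-increasing and right-continuous in the margin, so if the equation has several solutions, the
  infimum is the smallest of them.
\<close>

definition margin :: "('w, 'n::finite) net \<Rightarrow> 'n \<Rightarrow> ('n \<Rightarrow> real) \<Rightarrow> real" where
  "margin N j e = Inf {\<rho>. p_out N j e \<rho> = tolerance N j}"


definition is_posterior :: "('w, 'n::finite) net \<Rightarrow> 'n \<Rightarrow> bool" where
  "is_posterior N j \<longleftrightarrow>
     posterior N j \<in> row_space j \<rightarrow>\<^sub>M prob_algebra (row_space j) \<and>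
     (\<forall>k. \<forall>A\<in>sets (row_space j). \<forall>B\<in>sets (row_space j).
        measure (sample_space N)
          {\<omega> \<in> space (sample_space N).
             off_diag_row j (estim N k \<omega>) \<in> A \<and> off_diag_row j (cross N k \<omega>) \<in> B}
        = (\<integral>\<omega>. indicator A (off_diag_row j (estim N k \<omega>))
               * measure (posterior N j (off_diag_row j (estim N k \<omega>))) B \<partial>sample_space N))"

text \<open>
  The requirement that the posterior charges only non-negative rates follows almost surely from the
  non-negativity of the rates; imposing it everywhere only fixes a version of the posterior.
\<close>

definition network :: "('w, 'n::finite) net \<Rightarrow> bool" where
  "network N \<longleftrightarrow>
     prob_space (sample_space N) \<and>
     (\<forall>k. channel_state N k \<in> borel_measurable (sample_space N)) \<and>
     prob_space.indep_vars (sample_space N) (\<lambda>_. borel) (channel_state N) UNIV \<and>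
     (\<forall>k. distr (sample_space N) borel (channel_state N k)
          = distr (sample_space N) borel (channel_state N 0)) \<and>
     (\<forall>k. \<forall>\<omega>\<in>space (sample_space N). \<forall>j. uplink N k \<omega> $ j \<ge> 0) \<and>
     (\<forall>k. \<forall>\<omega>\<in>space (sample_space N). \<forall>j i. i \<noteq> j \<longrightarrow> cross N k \<omega> $ j $ i \<ge> 0) \<and>
     (\<forall>j. is_posterior N j) \<and>
     (\<forall>k. \<forall>\<omega>\<in>space (sample_space N). \<forall>j.
        AE r in posterior N j (off_diag_row j (estim N k \<omega>)). \<forall>i\<in>- {j}. r i \<ge> 0) \<and>
     (\<forall>j. 0 < tolerance N j \<and> tolerance N j < 1) \<and>
     (\<forall>k. \<forall>\<omega>\<in>space (sample_space N). \<forall>j.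
        \<exists>\<rho>. p_out N j (off_diag_row j (estim N k \<omega>)) \<rho> = tolerance N j) \<and>
     (\<forall>j. inj_max_p N j \<ge> 0 \<and> inj_max_o N j \<ge> 0) \<and>
     (\<forall>j. concave_on {0..} (util_p N j) \<and> mono_on {0..} (util_p N j) \<and> util_p N j 0 = 0) \<and>
     (\<forall>j. concave_on {0..} (util_o N j) \<and> mono_on {0..} (util_o N j) \<and> util_o N j 0 = 0) \<and>
     (\<forall>j. \<forall>x>0. util_p N j x > util_o N j x)"

definition bounded_rates :: "('w, 'n::finite) net \<Rightarrow> bool" where
  "bounded_rates N \<longleftrightarrow>
     (\<exists>c. \<forall>k. \<forall>\<omega>\<in>space (sample_space N). \<forall>j. uplink N k \<omega> $ j \<le> c)"


definition service_p :: "real \<Rightarrow> real \<Rightarrow> real \<Rightarrow> real" where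
  "service_p r \<rho> ip = ip * max 0 (r - \<rho>)"

definition service_o :: "real \<Rightarrow> real \<Rightarrow> real \<Rightarrow> real \<Rightarrow> real" where
  "service_o r \<rho> ip io = io * r + ip * (r - service_p r \<rho> ip)"

definition valid_mode :: "('n::finite \<Rightarrow> real) \<times> ('n \<Rightarrow> real) \<Rightarrow> bool" where
  "valid_mode = (\<lambda>(ip, io).
     (\<forall>j. ip j \<in> {0, 1} \<and> io j \<in> {0, 1}) \<and> (\<Sum>j\<in>UNIV. ip j + io j) \<le> 1)"

definition allowed :: "('w, 'n::finite) net \<Rightarrow> 'n \<Rightarrow> real \<times> real \<Rightarrow> bool" where
  "allowed N j = (\<lambda>(a, b). 0 \<le> a \<and> a \<le> inj_max_p N j \<and> 0 \<le> b \<and> b \<le> inj_max_o N j)"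


text \<open>
  A stationary, queue-independent, possibly randomised scheduling policy: given the observation
  \<open>s\<close>, node \<open>j\<close> sends in the joint mode with probability \<open>\<pi>p j s\<close> and in the open mode with
  probability \<open>\<pi>o j s\<close>, using any margin \<open>m j s\<close> that meets the outage constraint.
\<close>

definition stationary_policy ::
    "('w, 'n::finite) net \<Rightarrow> ('n \<Rightarrow> (real ^ 'n) \<times> (real ^ 'n ^ 'n) \<Rightarrow> real) \<Rightarrow>
     ('n \<Rightarrow> (real ^ 'n) \<times> (real ^ 'n ^ 'n) \<Rightarrow> real) \<Rightarrow>
     ('n \<Rightarrow> (real ^ 'n) \<times> (real ^ 'n ^ 'n) \<Rightarrow> real) \<Rightarrow> bool" where
  "stationary_policy N \<pi>p \<pi>o m \<longleftrightarrow>
     (\<forall>j. \<pi>p j \<in> borel_measurable borel \<and> \<pi>o j \<in> borel_measurable borel \<and>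
          m j \<in> borel_measurable borel) \<and>
     (\<forall>s. (\<forall>j. \<pi>p j s \<ge> 0 \<and> \<pi>o j s \<ge> 0) \<and> (\<Sum>j\<in>UNIV. \<pi>p j s + \<pi>o j s) \<le> 1) \<and>
     (\<forall>k. \<forall>\<omega>\<in>space (sample_space N). \<forall>j.
        p_out N j (off_diag_row j (estim N k \<omega>)) (m j (observation N k \<omega>)) = tolerance N j)"

text \<open>
  Block 0 stands for any block, since the channel is i.i.d. The indicators are 0 or 1, hence the
  conditional mean of each service rate given the observation is the probability-weighted sum of the
  service rates in the two modes.
\<close>

definition mean_service_p ::
    "('w, 'n::finite) net \<Rightarrow> ('n \<Rightarrow> (real ^ 'n) \<times> (real ^ 'n ^ 'n) \<Rightarrow> real) \<Rightarrow>
     ('n \<Rightarrow> (real ^ 'n) \<times> (real ^ 'n ^ 'n) \<Rightarrow> real) \<Rightarrow> 'n \<Rightarrow> real" where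
  "mean_service_p N \<pi>p m j =
     (\<integral>\<omega>. \<pi>p j (observation N 0 \<omega>) *
          service_p (uplink N 0 \<omega> $ j) (m j (observation N 0 \<omega>)) 1 \<partial>sample_space N)"

definition mean_service_o ::
    "('w, 'n::finite) net \<Rightarrow> ('n \<Rightarrow> (real ^ 'n) \<times> (real ^ 'n ^ 'n) \<Rightarrow> real) \<Rightarrow>
     ('n \<Rightarrow> (real ^ 'n) \<times> (real ^ 'n ^ 'n) \<Rightarrow> real) \<Rightarrow>
     ('n \<Rightarrow> (real ^ 'n) \<times> (real ^ 'n ^ 'n) \<Rightarrow> real) \<Rightarrow> 'n \<Rightarrow> real" where
  "mean_service_o N \<pi>p \<pi>o m j =
     (\<integral>\<omega>. \<pi>p j (observation N 0 \<omega>) *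
            service_o (uplink N 0 \<omega> $ j) (m j (observation N 0 \<omega>)) 1 0 +
          \<pi>o j (observation N 0 \<omega>) *
            service_o (uplink N 0 \<omega> $ j) (m j (observation N 0 \<omega>)) 0 1 \<partial>sample_space N)"

definition rate_region :: "('w, 'n::finite) net \<Rightarrow> (('n \<Rightarrow> real) \<times> ('n \<Rightarrow> real)) set" where
  "rate_region N =
     {(lp, lo). (\<forall>j. lp j \<ge> 0 \<and> lo j \<ge> 0) \<and>
        (\<exists>\<epsilon>>0. \<exists>\<pi>p \<pi>o m. stationary_policy N \<pi>p \<pi>o m \<and>
           (\<forall>j. mean_service_p N \<pi>p m j \<ge> lp j + \<epsilon> \<and>
                mean_service_o N \<pi>p \<pi>o m j \<ge> lo j + \<epsilon>))}"


text \<open>Expected utilities of one block, as functionals of the random injections in that block.\<close>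

definition exp_gp :: "('w, 'n::finite) net \<Rightarrow> ('w \<Rightarrow> 'n \<Rightarrow> real) \<Rightarrow> 'n \<Rightarrow> real" where
  "exp_gp N a j = (1 - tolerance N j) * (\<integral>\<omega>. util_p N j (a \<omega> j) \<partial>sample_space N)"

definition exp_go ::
    "('w, 'n::finite) net \<Rightarrow> ('w \<Rightarrow> 'n \<Rightarrow> real) \<Rightarrow> ('w \<Rightarrow> 'n \<Rightarrow> real) \<Rightarrow> 'n \<Rightarrow> real" where
  "exp_go N a b j =
     tolerance N j * (\<integral>\<omega>. util_o N j (a \<omega> j + b \<omega> j) \<partial>sample_space N) +
     (1 - tolerance N j) * (\<integral>\<omega>. util_o N j (b \<omega> j) \<partial>sample_space N)"

definition block_utility ::
    "('w, 'n::finite) net \<Rightarrow> ('w \<Rightarrow> 'n \<Rightarrow> real) \<Rightarrow> ('w \<Rightarrow> 'n \<Rightarrow> real) \<Rightarrow> real" where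
  "block_utility N a b = (\<Sum>j\<in>UNIV. exp_gp N a j + exp_go N a b j)"

definition admissible ::
    "('w, 'n::finite) net \<Rightarrow> ('w \<Rightarrow> 'n \<Rightarrow> real) \<Rightarrow> ('w \<Rightarrow> 'n \<Rightarrow> real) \<Rightarrow> bool" where
  "admissible N a b \<longleftrightarrow>
     (\<forall>j. (\<lambda>\<omega>. a \<omega> j) \<in> borel_measurable (sample_space N) \<and>
          (\<lambda>\<omega>. b \<omega> j) \<in> borel_measurable (sample_space N) \<and>
          (\<forall>\<omega>\<in>space (sample_space N). allowed N j (a \<omega> j, b \<omega> j)))"

definition has_average_rate ::
    "('w, 'n::finite) net \<Rightarrow> (nat \<Rightarrow> 'w \<Rightarrow> 'n \<Rightarrow> real) \<Rightarrow> ('n \<Rightarrow> real) \<Rightarrow> bool" where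
  "has_average_rate N A l \<longleftrightarrow>
     (\<forall>j. (\<lambda>K. 1 / real K * (\<Sum>k<K. \<integral>\<omega>. A k \<omega> j \<partial>sample_space N)) \<longlonglongrightarrow> l j)"

text \<open>The constraint on the outage probability is part of the definition of the rate region.\<close>

definition feasible ::
    "('w, 'n::finite) net \<Rightarrow> (nat \<Rightarrow> 'w \<Rightarrow> 'n \<Rightarrow> real) \<Rightarrow> (nat \<Rightarrow> 'w \<Rightarrow> 'n \<Rightarrow> real) \<Rightarrow> bool" where
  "feasible N Ap Ao \<longleftrightarrow>
     (\<forall>k. admissible N (Ap k) (Ao k)) \<and>
     (\<exists>lp lo. has_average_rate N Ap lp \<and> has_average_rate N Ao lo \<and> (lp, lo) \<in> rate_region N)"

definition average_utility ::
    "('w, 'n::finite) net \<Rightarrow> (nat \<Rightarrow> 'w \<Rightarrow> 'n \<Rightarrow> real) \<Rightarrow> (nat \<Rightarrow> 'w \<Rightarrow> 'n \<Rightarrow> real) \<Rightarrow> ereal" where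
  "average_utility N Ap Ao =
     liminf (\<lambda>K. ereal (1 / real K * (\<Sum>k<K. block_utility N (Ap k) (Ao k))))"

text \<open>The value of an infeasible problem is \<open>-\<infinity>\<close>.\<close>

definition g_star :: "('w, 'n::finite) net \<Rightarrow> ereal" where
  "g_star N = Sup {average_utility N Ap Ao | Ap Ao. feasible N Ap Ao}"

definition g_bar :: "('w, 'n::finite) net \<Rightarrow> ereal" where
  "g_bar N = Sup {ereal (block_utility N a b) | a b. admissible N a b}"

text \<open>
  Every vector of the rate region is supported with positive slack, so the region is not closed and
  \<open>g_star\<close> need not be attained. The only situation excluded here is that the unattained supremum
  equals the maximum possible aggregate utility: the network is then critically loaded by the
  largest allowed injections, and backlogs bounded independently of \<open>V\<close> cannot be expected.
\<close>

definition nondegenerate :: "('w, 'n::finite) net \<Rightarrow> bool" where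
  "nondegenerate N \<longleftrightarrow>
     (\<exists>Ap Ao. feasible N Ap Ao \<and> average_utility N Ap Ao = g_star N) \<or> g_star N < g_bar N"


text \<open>
  \<open>H k\<close> collects the events known before the channel of block \<open>k\<close> is realised. It only serves to
  let ties in the two maximisations be broken in an arbitrary causal, possibly randomised, way.
\<close>

definition history :: "('w, 'n::finite) net \<Rightarrow> (nat \<Rightarrow> 'w measure) \<Rightarrow> bool" where
  "history N H \<longleftrightarrow>
     (\<forall>k. subalgebra (sample_space N) (H k) \<and> sets (H k) \<subseteq> sets (H (Suc k)) \<and>
          channel_state N k \<in> borel_measurable (H (Suc k)) \<and>
          prob_space.indep_set (sample_space N) (sets (H k))
            (sets (vimage_algebra (space (sample_space N)) (channel_state N k) borel)))"

definition runs_control_algorithm ::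
    "('w, 'n::finite) net \<Rightarrow> real \<Rightarrow>
     (nat \<Rightarrow> 'w \<Rightarrow> 'n \<Rightarrow> real) \<Rightarrow> (nat \<Rightarrow> 'w \<Rightarrow> 'n \<Rightarrow> real) \<Rightarrow>
     (nat \<Rightarrow> 'w \<Rightarrow> 'n \<Rightarrow> real) \<Rightarrow> (nat \<Rightarrow> 'w \<Rightarrow> 'n \<Rightarrow> real) \<Rightarrow>
     (nat \<Rightarrow> 'w \<Rightarrow> 'n \<Rightarrow> real) \<Rightarrow> (nat \<Rightarrow> 'w \<Rightarrow> 'n \<Rightarrow> real) \<Rightarrow> bool" where
  "runs_control_algorithm N V Qp Qo Ap Ao Ip Io \<longleftrightarrow>
     (\<exists>H. history N H \<and>
        (\<forall>k j. (\<lambda>\<omega>. Ap k \<omega> j) \<in> borel_measurable (H (Suc k)) \<and>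
               (\<lambda>\<omega>. Ao k \<omega> j) \<in> borel_measurable (H (Suc k)) \<and>
               (\<lambda>\<omega>. Ip k \<omega> j) \<in> borel_measurable (H (Suc k)) \<and>
               (\<lambda>\<omega>. Io k \<omega> j) \<in> borel_measurable (H (Suc k)))) \<and>
     (\<exists>qp qo. \<forall>j. qp j \<ge> 0 \<and> qo j \<ge> 0 \<and>
        (\<forall>\<omega>\<in>space (sample_space N). Qp 0 \<omega> j = qp j \<and> Qo 0 \<omega> j = qo j)) \<and>
     (\<forall>k. \<forall>\<omega>\<in>space (sample_space N).
        (let \<rho> = (\<lambda>j. margin N j (off_diag_row j (estim N k \<omega>)));
             Rp = (\<lambda>ip j. service_p (uplink N k \<omega> $ j) (\<rho> j) (ip j));
             Ro = (\<lambda>ip io j. service_o (uplink N k \<omega> $ j) (\<rho> j) (ip j) (io j))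
         in (\<forall>j. is_arg_max
                (\<lambda>(a, b). V * (util_p N j a * (1 - tolerance N j)
                               + util_o N j b * (1 - tolerance N j)
                               + util_o N j (b + a) * tolerance N j)
                          - Qp k \<omega> j * a - Qo k \<omega> j * b)
                (allowed N j) (Ap k \<omega> j, Ao k \<omega> j)) \<and>
            is_arg_max
              (\<lambda>(ip, io). \<Sum>j\<in>UNIV. Qp k \<omega> j * Rp ip j + Qo k \<omega> j * Ro ip io j)
              valid_mode (Ip k \<omega>, Io k \<omega>) \<and>
            (\<forall>j. Qp (Suc k) \<omega> j = max 0 (Qp k \<omega> j - Rp (Ip k \<omega>) j) + Ap k \<omega> j) \<and>
            (\<forall>j. Qo (Suc k) \<omega> j
                 = max 0 (Qo k \<omega> j - Ro (Ip k \<omega>) (Io k \<omega>) j) + Ao k \<omega> j)))"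

end

theory Submission
  imports Defs
begin

text \<open>
  Lyapunov drift plus penalty. For a quadratic Lyapunov function of the queues, the two maximisations
  of the algorithm make the expected drift minus \<open>V\<close> times the utility of a block at most that of any
  competitor using constant injections \<open>(x, y)\<close> and a stationary policy that serves them with slack
  \<open>\<delta>\<close>. Queues are independent of the channel of the current block, so the drift is at most a constant
  minus \<open>\<delta>\<close> times the expected backlog; telescoping gives all three bounds with the utility of
  \<open>(x, y)\<close> in place of \<open>g_star\<close>. By Jensen's inequality such constant injections do at least as
  well as any given feasible sequence.
\<close>

section \<open>Jensen's inequality for time averages and independence\<close>

text \<open>The two kinds of bounds use the competitor differently. For the utility bound the
  backlog term is dropped, so the slack disappears and one constant serves every sustainable point;
  the supremum can then be taken although it need not be attained. In the backlog bounds the slack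
  stays as a denominator, and it may tend to 0 along points approaching the supremum. Hence a single
  point is fixed for the network, before \<open>V\<close>, and its shortfall from
  \<open>g_bar\<close> is compared with that of \<open>g_star\<close>; nondegeneracy makes this
  comparison possible.

  Two further obstacles shape the proof. A competing policy may use any margin that meets the outage
  constraint, while the algorithm uses the smallest one. And this smallest margin is an infimum over
  a set of real solutions, so the measurability of the service rates, which places the queues in the
  past of the current channel, needs a detour through the rationals.\<close>

lemma concave_supporting_line:
  fixes U :: "real \<Rightarrow> real"
  assumes conc: "concave_on {0..} U" and mono: "mono_on {0..} U" and x: "0 < x"
  obtains s where "0 \<le> s" "\<And>z. 0 \<le> z \<Longrightarrow> U z \<le> U x + s * (z - x)"
proof -
  \<comment> \<open>The infimum is the right derivative of the convex function \<open>- U\<close> at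
    \<open>x\<close>, so \<open>s\<close> is the right derivative of \<open>U\<close>. It is a
    supporting slope because \<open>x\<close> is interior to the half-line.\<close>
  define s where "s = - Inf ((\<lambda>t. (- U x - - U t) / (x - t)) ` ({x<..} \<inter> {0..}))"
  have line: "U z \<le> U x + s * (z - x)" if "0 \<le> z" for z
  proof -
    have "- U x + Inf ((\<lambda>t. (- U x - - U t) / (x - t)) ` ({x<..} \<inter> {0..})) * (z - x) \<le> - U z"
      using conc x that by (intro convex_le_Inf_differential) (auto simp: concave_on_def)
    then show ?thesis by (simp add: s_def)
  qed
  \<comment> \<open>One point to the right of \<open>x\<close> is enough to see that the slope is
    nonnegative.\<close>
  have "U x \<le> U (x + 1)"
    using x by (intro mono_onD[OF mono]) auto
  with line[of "x + 1"] x have "0 \<le> s" by simp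
  with line show thesis by (rule that[rotated])
qed

text \<open>Precomposing \<open>U\<close> with \<open>max 0\<close> gives a function that is
  monotone on the whole line, hence Borel, and that agrees with \<open>U\<close> on all values of
  \<open>Z\<close>.\<close>

lemma mono_on_nonneg_measurable:
  fixes U :: "real \<Rightarrow> real"
  assumes mono: "mono_on {0..} U" and Z: "Z \<in> borel_measurable M"
    and nonneg: "\<And>\<omega>. \<omega> \<in> space M \<Longrightarrow> 0 \<le> Z \<omega>"
  shows "(\<lambda>\<omega>. U (Z \<omega>)) \<in> borel_measurable M"
proof -
  have "(\<lambda>x. U (max 0 x)) \<in> borel_measurable borel"
    by (intro borel_measurable_mono monoI mono_onD[OF mono]) auto
  then have "(\<lambda>\<omega>. U (max 0 (Z \<omega>))) \<in> borel_measurable M"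
    using Z by measurable
  then show ?thesis
    by (rule measurable_cong[THEN iffD1, rotated]) (auto simp: nonneg max_def)
qed

context prob_space
begin

lemma integrable_bounded:
  fixes f :: "'a \<Rightarrow> real"
  assumes "f \<in> borel_measurable M" "\<And>\<omega>. \<omega> \<in> space M \<Longrightarrow> \<bar>f \<omega>\<bar> \<le> C"
  shows "integrable M f"
  using assms by (intro integrable_const_bound[where B = C]) auto

lemma integrable_mono_on:
  fixes U :: "real \<Rightarrow> real"
  assumes mono: "mono_on {0..} U" and Z: "Z \<in> borel_measurable M"
    and bounds: "\<And>\<omega>. \<omega> \<in> space M \<Longrightarrow> 0 \<le> Z \<omega> \<and> Z \<omega> \<le> C"
  shows "integrable M (\<lambda>\<omega>. U (Z \<omega>))"
proof (rule integrable_bounded[where C = "max \<bar>U 0\<bar> \<bar>U C\<bar>"])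
  show "(\<lambda>\<omega>. U (Z \<omega>)) \<in> borel_measurable M"
    using bounds by (intro mono_on_nonneg_measurable[OF mono Z]) auto
  fix \<omega> assume "\<omega> \<in> space M"
  with bounds[of \<omega>] mono_onD[OF mono, of 0 "Z \<omega>"] mono_onD[OF mono, of "Z \<omega>" C]
  show "\<bar>U (Z \<omega>)\<bar> \<le> max \<bar>U 0\<bar> \<bar>U C\<bar>"
    by auto
qed

text \<open>A single supporting line at \<open>x\<close> handles the expectation and the time
  average together. As its slope is nonnegative, an average of at most \<open>x\<close> suffices. At
  \<open>x = 0\<close> there may be no such line, since \<open>U\<close> may jump there;
  \<open>deg\<close> then forces every \<open>Z k\<close> to vanish.\<close>

lemma average_concave_le:
  fixes U :: "real \<Rightarrow> real"
  assumes conc: "concave_on {0..} U" and mono: "mono_on {0..} U"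
    and meas: "\<And>k::nat. Z k \<in> borel_measurable M"
    and bounds: "\<And>k \<omega>. \<omega> \<in> space M \<Longrightarrow> 0 \<le> Z k \<omega> \<and> Z k \<omega> \<le> C"
    and x: "0 \<le> x" and deg: "x = 0 \<Longrightarrow> C = 0"
    and K: "0 < K" and avg: "1 / real K * (\<Sum>k<K. expectation (Z k)) \<le> x"
  shows "1 / real K * (\<Sum>k<K. expectation (\<lambda>\<omega>. U (Z k \<omega>))) \<le> U x"
proof (cases "x = 0")
  case True
  have "expectation (\<lambda>\<omega>. U (Z k \<omega>)) = expectation (\<lambda>\<omega>. U 0)" for k
  proof (intro Bochner_Integration.integral_cong refl)
    fix \<omega> assume "\<omega> \<in> space M"
    with bounds[of \<omega> k] deg[OF True] have "Z k \<omega> = 0" by simp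
    then show "U (Z k \<omega>) = U 0" by simp
  qed
  with True K show ?thesis by (simp add: prob_space)
next
  case False
  with x have "0 < x" by simp
  from concave_supporting_line[OF conc mono this]
  obtain s where s: "0 \<le> s" "\<And>z. 0 \<le> z \<Longrightarrow> U z \<le> U x + s * (z - x)"
    by blast
  have int: "integrable M (Z k)" for k
    using bounds by (intro integrable_bounded[OF meas, of _ C]) auto
  have "expectation (\<lambda>\<omega>. U (Z k \<omega>)) \<le> U x + s * (expectation (Z k) - x)" for k
  proof -
    have "expectation (\<lambda>\<omega>. U (Z k \<omega>)) \<le> expectation (\<lambda>\<omega>. U x + s * (Z k \<omega> - x))"
    proof (rule integral_mono)
      show "integrable M (\<lambda>\<omega>. U (Z k \<omega>))"
        using bounds by (rule integrable_mono_on[OF mono meas])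
      show "integrable M (\<lambda>\<omega>. U x + s * (Z k \<omega> - x))"
        using int by simp
      show "U (Z k \<omega>) \<le> U x + s * (Z k \<omega> - x)" if "\<omega> \<in> space M" for \<omega>
        using bounds[OF that] by (intro s(2)) simp
    qed
    also have "\<dots> = U x + s * (expectation (Z k) - x)"
      using int by (simp add: prob_space)
    finally show ?thesis .
  qed
  then have "(\<Sum>k<K. expectation (\<lambda>\<omega>. U (Z k \<omega>))) \<le> (\<Sum>k<K. U x + s * (expectation (Z k) - x))"
    by (intro sum_mono)
  also have "\<dots> = real K * (U x - s * x) + s * (\<Sum>k<K. expectation (Z k))"
    by (simp add: sum.distrib sum_distrib_left sum_subtractf right_diff_distrib)
  finally have "1 / real K * (\<Sum>k<K. expectation (\<lambda>\<omega>. U (Z k \<omega>)))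
      \<le> 1 / real K * (real K * (U x - s * x) + s * (\<Sum>k<K. expectation (Z k)))"
    by (rule mult_left_mono) simp
  also have "\<dots> = U x - s * x + s * (1 / real K * (\<Sum>k<K. expectation (Z k)))"
    using K by (simp only: distrib_left) simp
  also have "\<dots> \<le> U x - s * x + s * x"
    using s(1) avg by (intro add_left_mono mult_left_mono)
  finally show ?thesis by simp
qed

text \<open>Links independence of event families, the form found in \<open>history\<close>, to the
  product rule for expectations: \<open>X\<close> generates a sub-sigma-algebra of \<open>F\<close>,
  and \<open>f\<close> applied to \<open>S\<close> one of that generated by \<open>S\<close>. Later
  \<open>X\<close> is a queue length and \<open>S\<close> the channel state of the same
  block.\<close>

lemma expectation_mult_indep:
  fixes X :: "'a \<Rightarrow> real" and S :: "'a \<Rightarrow> 's::topological_space" and f :: "'s \<Rightarrow> real"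
  assumes F: "subalgebra M F" and X: "X \<in> borel_measurable F"
    and S: "S \<in> borel_measurable M" and f: "f \<in> borel_measurable borel"
    and indep: "indep_set (sets F) (sets (vimage_algebra (space M) S borel))"
    and int: "integrable M X" "integrable M (\<lambda>\<omega>. f (S \<omega>))"
  shows "expectation (\<lambda>\<omega>. X \<omega> * f (S \<omega>)) = expectation X * expectation (\<lambda>\<omega>. f (S \<omega>))"
    and "integrable M (\<lambda>\<omega>. X \<omega> * f (S \<omega>))"
proof -
  have space: "space F = space M"
    using F by (simp add: subalgebra_def)
  have fS: "(\<lambda>\<omega>. f (S \<omega>)) \<in> borel_measurable (vimage_algebra (space M) S borel)"
    using measurable_compose[OF measurable_vimage_algebra1 f, of S "space M"] by simp
  have "sigma_sets (space M) {X -` A \<inter> space M | A. A \<in> sets borel} \<subseteq> sets F"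
    using measurable_sets[OF X] by (intro sets.sigma_sets_subset[of _ F, unfolded space]) (auto simp: space)
  moreover have "sigma_sets (space M) {(\<lambda>\<omega>. f (S \<omega>)) -` A \<inter> space M | A. A \<in> sets borel}
      \<subseteq> sets (vimage_algebra (space M) S borel)"
    using measurable_sets[OF fS]
    by (intro sets.sigma_sets_subset[of _ "vimage_algebra (space M) S borel", unfolded space_vimage_algebra]) auto
  ultimately have "indep_set (sigma_sets (space M) {X -` A \<inter> space M | A. A \<in> sets borel})
      (sigma_sets (space M) {(\<lambda>\<omega>. f (S \<omega>)) -` A \<inter> space M | A. A \<in> sets borel})"
    unfolding indep_set_def
    by (intro indep_sets_mono_sets[OF indep[unfolded indep_set_def]]) (auto split: bool.split)
  then have "indep_var borel X borel (\<lambda>\<omega>. f (S \<omega>))"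
    using measurable_from_subalg[OF F X] S f by (auto simp: indep_var_eq)
  then show "expectation (\<lambda>\<omega>. X \<omega> * f (S \<omega>)) = expectation X * expectation (\<lambda>\<omega>. f (S \<omega>))"
    "integrable M (\<lambda>\<omega>. X \<omega> * f (S \<omega>))"
    using int by (auto intro: indep_var_lebesgue_integral indep_var_integrable)
qed

end

section \<open>Margins\<close>

lemma measurable_off_diag_row: "off_diag_row j \<in> borel \<rightarrow>\<^sub>M row_space j"
  unfolding off_diag_row_def row_space_def
  by (intro measurable_restrict borel_measurable_continuous_onI continuous_intros)

locale wireless_network =
  fixes N :: "('w, 'n::finite) net" and c :: real
  assumes net: "network N"
    and uplink_le: "\<And>k \<omega> j. \<omega> \<in> space (sample_space N) \<Longrightarrow> uplink N k \<omega> $ j \<le> c"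
begin

abbreviation M where "M \<equiv> sample_space N"
abbreviation \<gamma> where "\<gamma> \<equiv> tolerance N"
abbreviation est where "est j k \<omega> \<equiv> off_diag_row j (estim N k \<omega>)"
abbreviation rho where "rho k \<omega> j \<equiv> margin N j (est j k \<omega>)"

sublocale prob_space M
  using net by (simp add: network_def)

lemma channel_measurable: "channel_state N k \<in> borel_measurable M"
  and channel_distr: "distr M borel (channel_state N k) = distr M borel (channel_state N 0)"
  and uplink_nonneg: "\<omega> \<in> space M \<Longrightarrow> 0 \<le> uplink N k \<omega> $ j"
  and post: "is_posterior N j"
  and post_nonneg: "\<omega> \<in> space M \<Longrightarrow> AE r in posterior N j (est j k \<omega>). \<forall>i\<in>- {j}. r i \<ge> 0"
  and tol: "0 < \<gamma> j" "\<gamma> j < 1"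
  and margin_ex: "\<omega> \<in> space M \<Longrightarrow> \<exists>\<rho>. p_out N j (est j k \<omega>) \<rho> = \<gamma> j"
  and inj_nonneg: "0 \<le> inj_max_p N j" "0 \<le> inj_max_o N j"
  and util_p: "concave_on {0..} (util_p N j)" "mono_on {0..} (util_p N j)" "util_p N j 0 = 0"
  and util_o: "concave_on {0..} (util_o N j)" "mono_on {0..} (util_o N j)" "util_o N j 0 = 0"
  using net by (simp_all add: network_def)

lemma rate_bound_nonneg: "0 \<le> c"
proof -
  obtain \<omega> where "\<omega> \<in> space M" using not_empty by blast
  then show ?thesis using uplink_nonneg uplink_le order_trans by blast
qed

lemma est_in_space: "est j k \<omega> \<in> space (row_space j)"
  using measurable_space[OF measurable_off_diag_row, of "estim N k \<omega>" j] by simp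

lemma posterior_measurable: "posterior N j \<in> row_space j \<rightarrow>\<^sub>M prob_algebra (row_space j)"
  using post[of j] by (simp add: is_posterior_def)

lemma posterior_prob_space:
  assumes "e \<in> space (row_space j)"
  shows "prob_space (posterior N j e)" "sets (posterior N j e) = sets (row_space j)"
    "space (posterior N j e) = space (row_space j)"
  using measurable_space[OF posterior_measurable assms]
  by (auto simp: space_prob_algebra dest: sets_eq_imp_space_eq)

lemma outage_event: "{r \<in> space (row_space (j::'n)). Max (r ` (- {j})) > (\<rho>::real)} \<in> sets (row_space j)"
proof -
  have "(\<lambda>r. Max ((\<lambda>i. r i) ` (- {j})) :: real) \<in> borel_measurable (row_space j)"
    unfolding row_space_def by (intro borel_measurable_Max) (auto intro: measurable_component_singleton)
  then show ?thesis by measurable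
qed

lemma p_out_eq:
  assumes "e \<in> space (row_space j)"
  shows "p_out N j e \<rho>
    = measure (posterior N j e) {r \<in> space (row_space j). Max (r ` (- {j})) > \<rho>}"
  by (simp add: p_out_def posterior_prob_space[OF assms])

lemma p_out_antimono:
  assumes e: "e \<in> space (row_space j)" and "\<rho> \<le> \<rho>'"
  shows "p_out N j e \<rho>' \<le> p_out N j e \<rho>"
proof -
  interpret P: prob_space "posterior N j e" by (rule posterior_prob_space[OF e])
  show ?thesis
    unfolding p_out_eq[OF e] using \<open>\<rho> \<le> \<rho>'\<close> outage_event
    by (intro P.finite_measure_mono) (auto simp: posterior_prob_space(2)[OF e])
qed

lemma p_out_measurable:
  assumes "estim N k \<in> borel_measurable F"
  shows "(\<lambda>\<omega>. p_out N j (est j k \<omega>) \<rho>) \<in> borel_measurable F"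
proof -
  have "(\<lambda>e. measure (posterior N j e) {r \<in> space (row_space j). Max (r ` (- {j})) > \<rho>})
      \<in> borel_measurable (row_space j)"
    using outage_event
    by (intro measurable_compose[OF posterior_measurable] measurable_measure_prob_algebra)
  from measurable_compose[OF measurable_compose[OF assms measurable_off_diag_row] this]
  show ?thesis by (simp add: p_out_eq est_in_space)
qed

text \<open>With a single node there are no other receivers, \<open>Max\<close> of the empty set is an unspecified
  constant, and the outage probability is 0 or 1, contradicting the solvability assumption.\<close>

lemma solution_nonneg:
  assumes \<omega>: "\<omega> \<in> space M" and sol: "p_out N j (est j k \<omega>) \<rho> = \<gamma> j"
  shows "0 \<le> \<rho>"
proof (rule ccontr)
  assume neg: "\<not> 0 \<le> \<rho>"
  let ?e = "est j k \<omega>" and ?E = "{r \<in> space (row_space j). Max (r ` (- {j})) > \<rho>}"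
  note e = est_in_space[of j k \<omega>]
  interpret P: prob_space "posterior N j ?e" by (rule posterior_prob_space[OF e])
  have p: "P.prob ?E = \<gamma> j"
    using sol by (simp add: p_out_eq[OF e])
  show False
  proof (cases "- {j} = {}")
    case True
    then have "?E = {} \<or> ?E = space (posterior N j ?e)"
      by (auto simp: posterior_prob_space(3)[OF e])
    then have "P.prob ?E = 0 \<or> P.prob ?E = 1"
      by (auto simp only: P.prob_space measure_empty)
    with p tol[of j] show False by simp
  next
    case False
    \<comment> \<open>Nonnegative rates almost surely exceed a negative margin, so the outage
      probability would be 1.\<close>
    have "AE r in posterior N j ?e. r \<in> ?E"
      using post_nonneg[OF \<omega>, of j k] AE_space
    proof eventually_elim
      case (elim r)
      with False obtain i where "i \<in> - {j}" "0 \<le> r i" by auto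
      then have "0 \<le> Max (r ` (- {j}))" by (subst Max_ge_iff) auto
      with neg elim(2) show ?case by (simp add: posterior_prob_space(3)[OF e])
    qed
    moreover have "?E \<in> P.events"
      using outage_event by (simp add: posterior_prob_space(2)[OF e])
    ultimately have "P.prob ?E = 1"
      using P.prob_eq_1 by blast
    with p tol[of j] show False by simp
  qed
qed

text \<open>Nonnegativity of all solutions bounds the set below, so that its infimum is a true lower
  bound.\<close>

lemma margin_le:
  assumes "\<omega> \<in> space M" "p_out N j (est j k \<omega>) \<rho> = \<gamma> j"
  shows "rho k \<omega> j \<le> \<rho>"
  unfolding margin_def using assms solution_nonneg[OF assms(1)]
  by (intro cInf_lower bdd_belowI[of _ 0]) auto

lemma margin_nonneg:
  assumes "\<omega> \<in> space M"
  shows "0 \<le> rho k \<omega> j"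
  unfolding margin_def using margin_ex[OF assms] solution_nonneg[OF assms]
  by (intro cInf_greatest) auto

text \<open>Describes the margin by countably many outage probabilities, from which measurability
  follows. A rational just above a solution need not be a solution, hence the inequality in place of
  the equation. Conversely, if a rational below a solution satisfies the inequality, monotonicity
  forces equality, so it is a solution itself.\<close>

lemma margin_less_iff:
  assumes \<omega>: "\<omega> \<in> space M"
  shows "rho k \<omega> j < y \<longleftrightarrow> (\<exists>q::rat. of_rat q < y \<and> p_out N j (est j k \<omega>) (of_rat q) \<le> \<gamma> j)"
proof
  assume "rho k \<omega> j < y"
  then obtain \<rho> where "p_out N j (est j k \<omega>) \<rho> = \<gamma> j" "\<rho> < y"
    unfolding margin_def using margin_ex[OF \<omega>, of j k] by (auto dest: cInf_lessD[rotated])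
  moreover from \<open>\<rho> < y\<close> obtain q where "\<rho> < of_rat q" "of_rat q < y"
    using of_rat_dense by blast
  ultimately show "\<exists>q::rat. of_rat q < y \<and> p_out N j (est j k \<omega>) (of_rat q) \<le> \<gamma> j"
    using p_out_antimono[OF est_in_space, of \<rho> "of_rat q" j k \<omega>] by (intro exI[of _ q]) auto
next
  assume "\<exists>q::rat. of_rat q < y \<and> p_out N j (est j k \<omega>) (of_rat q) \<le> \<gamma> j"
  then obtain q :: rat where q: "of_rat q < y" "p_out N j (est j k \<omega>) (of_rat q) \<le> \<gamma> j" by blast
  obtain \<rho> where \<rho>: "p_out N j (est j k \<omega>) \<rho> = \<gamma> j"
    using margin_ex[OF \<omega>] by blast
  show "rho k \<omega> j < y"
  proof (cases "\<rho> \<le> of_rat q")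
    case True
    with margin_le[OF \<omega> \<rho>] q(1) show ?thesis by simp
  next
    case False
    then have "p_out N j (est j k \<omega>) (of_rat q) = \<gamma> j"
      using p_out_antimono[OF est_in_space, of "of_rat q" \<rho> j k \<omega>] q(2) \<rho> by simp
    from margin_le[OF \<omega> this] q(1) show ?thesis by simp
  qed
qed

text \<open>\<open>F\<close> is kept general because the service rates have to be measurable with
  respect to the history up to the current block, not merely on the whole sample space.\<close>

lemma margin_measurable:
  assumes F: "space F = space M" and ch: "channel_state N k \<in> borel_measurable F"
  shows "(\<lambda>\<omega>. rho k \<omega> j) \<in> borel_measurable F"
proof (rule borel_measurableI_less)
  fix y :: real
  have "(\<lambda>s::(real^'n) \<times> (real^'n^'n) \<times> (real^'n^'n). snd (snd s)) \<in> borel_measurable borel"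
    by (intro borel_measurable_continuous_onI continuous_intros)
  from measurable_compose[OF ch this] have "estim N k \<in> borel_measurable F"
    by (simp add: channel_state_def)
  note [measurable] = p_out_measurable[OF this]
  have "{\<omega> \<in> space F. \<exists>q::rat. of_rat q < y \<and> p_out N j (est j k \<omega>) (of_rat q) \<le> \<gamma> j} \<in> sets F"
    by measurable
  also have "{\<omega> \<in> space F. \<exists>q::rat. of_rat q < y \<and> p_out N j (est j k \<omega>) (of_rat q) \<le> \<gamma> j}
      = {\<omega> \<in> space F. rho k \<omega> j < y}"
    by (intro Collect_cong conj_cong refl margin_less_iff[symmetric]) (simp add: F)
  finally show "{\<omega> \<in> space F. rho k \<omega> j < y} \<in> sets F" .
qed

lemma uplink_measurable:
  assumes ch: "channel_state N k \<in> borel_measurable F"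
  shows "(\<lambda>\<omega>. uplink N k \<omega> $ j) \<in> borel_measurable F"
proof -
  have "(\<lambda>s::(real^'n) \<times> (real^'n^'n) \<times> (real^'n^'n). fst s $ j) \<in> borel_measurable borel"
    by (intro borel_measurable_continuous_onI continuous_intros)
  from measurable_compose[OF ch this] show ?thesis by (simp add: channel_state_def)
qed

end

section \<open>Sustainable operating points\<close>

context wireless_network
begin

text \<open>The order of summands and factors is that of the flow control objective, so that the
  objective of the algorithm unfolds to exactly this term.\<close>

definition node_utility :: "'n \<Rightarrow> real \<Rightarrow> real \<Rightarrow> real" where
  "node_utility j a b =
     util_p N j a * (1 - \<gamma> j) + util_o N j b * (1 - \<gamma> j) + util_o N j (b + a) * \<gamma> j"

definition point_utility :: "('n \<Rightarrow> real) \<Rightarrow> ('n \<Rightarrow> real) \<Rightarrow> real" where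
  "point_utility x y = (\<Sum>j\<in>UNIV. node_utility j (x j) (y j))"

text \<open>A point of the rate region that can itself be injected in every block. The slack is a
  parameter because it becomes the denominator of the backlog bounds.\<close>

definition sustainable :: "('n \<Rightarrow> real) \<Rightarrow> ('n \<Rightarrow> real) \<Rightarrow> real \<Rightarrow> bool" where
  "sustainable x y \<delta> \<longleftrightarrow> 0 < \<delta> \<and> (\<forall>j. allowed N j (x j, y j)) \<and>
     (\<exists>\<pi>p \<pi>o m. stationary_policy N \<pi>p \<pi>o m \<and>
        (\<forall>j. mean_service_p N \<pi>p m j \<ge> x j + \<delta> \<and> mean_service_o N \<pi>p \<pi>o m j \<ge> y j + \<delta>))"

lemma admissibleD:
  assumes "admissible N a b"
  shows "(\<lambda>\<omega>. a \<omega> j) \<in> borel_measurable M" "(\<lambda>\<omega>. b \<omega> j) \<in> borel_measurable M"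
    "(\<lambda>\<omega>. a \<omega> j + b \<omega> j) \<in> borel_measurable M"
    "\<omega> \<in> space M \<Longrightarrow> 0 \<le> a \<omega> j \<and> a \<omega> j \<le> inj_max_p N j"
    "\<omega> \<in> space M \<Longrightarrow> 0 \<le> b \<omega> j \<and> b \<omega> j \<le> inj_max_o N j"
    "\<omega> \<in> space M \<Longrightarrow> 0 \<le> a \<omega> j + b \<omega> j \<and> a \<omega> j + b \<omega> j \<le> inj_max_p N j + inj_max_o N j"
proof -
  show *: "(\<lambda>\<omega>. a \<omega> j) \<in> borel_measurable M" "(\<lambda>\<omega>. b \<omega> j) \<in> borel_measurable M"
    using assms by (auto simp: admissible_def)
  then show "(\<lambda>\<omega>. a \<omega> j + b \<omega> j) \<in> borel_measurable M" by measurable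
  show "0 \<le> a \<omega> j \<and> a \<omega> j \<le> inj_max_p N j" "0 \<le> b \<omega> j \<and> b \<omega> j \<le> inj_max_o N j"
    "0 \<le> a \<omega> j + b \<omega> j \<and> a \<omega> j + b \<omega> j \<le> inj_max_p N j + inj_max_o N j" if "\<omega> \<in> space M"
    using assms that by (auto simp: admissible_def allowed_def add_mono)
qed

lemma admissible_integrable:
  assumes adm: "admissible N a b"
  shows "integrable M (\<lambda>\<omega>. util_p N j (a \<omega> j))" "integrable M (\<lambda>\<omega>. util_o N j (b \<omega> j))"
    "integrable M (\<lambda>\<omega>. util_o N j (a \<omega> j + b \<omega> j))"
    "integrable M (\<lambda>\<omega>. a \<omega> j)" "integrable M (\<lambda>\<omega>. b \<omega> j)"
proof -
  note D = admissibleD[OF adm]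
  show "integrable M (\<lambda>\<omega>. util_p N j (a \<omega> j))"
    using D(4) by (rule integrable_mono_on[OF util_p(2) D(1)])
  show "integrable M (\<lambda>\<omega>. util_o N j (b \<omega> j))"
    using D(5) by (rule integrable_mono_on[OF util_o(2) D(2)])
  show "integrable M (\<lambda>\<omega>. util_o N j (a \<omega> j + b \<omega> j))"
    using D(6) by (rule integrable_mono_on[OF util_o(2) D(3)])
  show "integrable M (\<lambda>\<omega>. a \<omega> j)"
    by (rule integrable_bounded[OF D(1), where C = "inj_max_p N j"]) (use D(4) in force)
  show "integrable M (\<lambda>\<omega>. b \<omega> j)"
    by (rule integrable_bounded[OF D(2), where C = "inj_max_o N j"]) (use D(5) in force)
qed

lemma block_utility_eq:
  assumes adm: "admissible N a b"
  shows "block_utility N a b = expectation (\<lambda>\<omega>. point_utility (a \<omega>) (b \<omega>))"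
    and "integrable M (\<lambda>\<omega>. point_utility (a \<omega>) (b \<omega>))"
proof -
  note [simp] = admissible_integrable[OF adm]
  have "exp_gp N a j + exp_go N a b j = expectation (\<lambda>\<omega>. node_utility j (a \<omega> j) (b \<omega> j))" for j
    by (simp add: exp_gp_def exp_go_def node_utility_def add.commute mult.commute)
  moreover have int: "integrable M (\<lambda>\<omega>. node_utility j (a \<omega> j) (b \<omega> j))" for j
    by (simp add: node_utility_def add.commute[of "b _ j"])
  ultimately show "block_utility N a b = expectation (\<lambda>\<omega>. point_utility (a \<omega>) (b \<omega>))"
    by (simp add: block_utility_def point_utility_def)
  from int show "integrable M (\<lambda>\<omega>. point_utility (a \<omega>) (b \<omega>))"
    by (simp add: point_utility_def)
qed

lemma node_utility_mono:
  assumes "0 \<le> a" "a \<le> a'" "0 \<le> b" "b \<le> b'"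
  shows "node_utility j a b \<le> node_utility j a' b'"
  unfolding node_utility_def using assms tol[of j]
  by (intro add_mono mult_right_mono mono_onD[OF util_p(2)] mono_onD[OF util_o(2)]) auto

lemma block_utility_le_max:
  assumes adm: "admissible N a b"
  shows "block_utility N a b \<le> point_utility (inj_max_p N) (inj_max_o N)"
proof -
  have "expectation (\<lambda>\<omega>. point_utility (a \<omega>) (b \<omega>))
      \<le> expectation (\<lambda>\<omega>. point_utility (inj_max_p N) (inj_max_o N))"
  proof (rule integral_mono)
    fix \<omega> assume "\<omega> \<in> space M"
    then show "point_utility (a \<omega>) (b \<omega>) \<le> point_utility (inj_max_p N) (inj_max_o N)"
      unfolding point_utility_def using admissibleD(4,5)[OF adm, of \<omega>]
      by (intro sum_mono node_utility_mono) auto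
  qed (simp_all add: block_utility_eq(2)[OF adm])
  then show ?thesis by (simp add: block_utility_eq(1)[OF adm] prob_space)
qed

lemma admissible_const:
  assumes "\<And>j. allowed N j (x j, y j)"
  shows "admissible N (\<lambda>_. x) (\<lambda>_. y)" "block_utility N (\<lambda>_. x) (\<lambda>_. y) = point_utility x y"
proof -
  show "admissible N (\<lambda>_. x) (\<lambda>_. y)" using assms by (simp add: admissible_def)
  from block_utility_eq(1)[OF this] show "block_utility N (\<lambda>_. x) (\<lambda>_. y) = point_utility x y"
    by (simp add: prob_space)
qed

text \<open>Monotone utilities make the largest allowed injections an upper bound, and injecting
  nothing is admissible, which excludes the value \<open>- \<infinity>\<close>.\<close>

lemma g_bar_finite:
  obtains b where "g_bar N = ereal b" "\<And>a a'. admissible N a a' \<Longrightarrow> block_utility N a a' \<le> b"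
proof -
  have le: "ereal (block_utility N a a') \<le> g_bar N" if "admissible N a a'" for a a'
    unfolding g_bar_def using that by (intro Sup_upper) auto
  have "g_bar N \<le> ereal (point_utility (inj_max_p N) (inj_max_o N))"
    unfolding g_bar_def by (intro Sup_least) (auto simp: block_utility_le_max)
  moreover have "ereal (point_utility (\<lambda>_. 0) (\<lambda>_. 0)) \<le> g_bar N"
    using le[of "\<lambda>_ _. 0" "\<lambda>_ _. 0"] admissible_const[of "\<lambda>_. 0" "\<lambda>_. 0"] inj_nonneg
    by (simp add: allowed_def)
  ultimately obtain b where "g_bar N = ereal b"
    by (cases "g_bar N") auto
  with le that show thesis by (metis ereal_less_eq(3))
qed

text \<open>The utilities may jump at 0, so the time average of the utilities of injections with average
  rate \<open>l\<close> can exceed the utility at \<open>l\<close>; half of the slack is spent to move to a point at which the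
  supporting lines of Jensen's inequality exist.\<close>

lemma feasible_sustainable:
  assumes feas: "feasible N Ap Ao"
  obtains x y \<delta> where "sustainable x y \<delta>" "average_utility N Ap Ao \<le> ereal (point_utility x y)"
proof -
  from feas obtain lp lo where adm: "\<And>k. admissible N (Ap k) (Ao k)"
    and rates: "has_average_rate N Ap lp" "has_average_rate N Ao lo"
    and region: "(lp, lo) \<in> rate_region N"
    by (auto simp: feasible_def)
  from region obtain \<epsilon> \<pi>p \<pi>o m where l: "\<And>j. 0 \<le> lp j" "\<And>j. 0 \<le> lo j" and \<epsilon>: "0 < \<epsilon>"
    and pol: "stationary_policy N \<pi>p \<pi>o m"
    and slack: "\<And>j. mean_service_p N \<pi>p m j \<ge> lp j + \<epsilon>" "\<And>j. mean_service_o N \<pi>p \<pi>o m j \<ge> lo j + \<epsilon>"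
    unfolding rate_region_def by blast
  \<comment> \<open>The cap keeps the point allowed. It does no harm to the comparison, since
    average injections never exceed the cap either.\<close>
  define x where "x j = min (lp j + \<epsilon> / 2) (inj_max_p N j)" for j
  define y where "y j = min (lo j + \<epsilon> / 2) (inj_max_o N j)" for j
  note D = admissibleD[OF adm] and I = admissible_integrable[OF adm]
  have nonneg: "0 \<le> x j" "0 \<le> y j" for j
    using l[of j] \<epsilon> inj_nonneg[of j] by (auto simp: x_def y_def)
  \<comment> \<open>As \<open>lp j + \<epsilon> / 2\<close> and \<open>lo j + \<epsilon> / 2\<close>
    are positive, a coordinate can vanish only through its cap. This is the degenerate case of
    \<open>average_concave_le\<close>.\<close>
  have deg: "x j = 0 \<Longrightarrow> inj_max_p N j = 0" "y j = 0 \<Longrightarrow> inj_max_o N j = 0" for j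
    using l[of j] \<epsilon> by (auto simp: x_def y_def min_def split: if_splits)
  have "x j + \<epsilon> / 2 \<le> mean_service_p N \<pi>p m j \<and> y j + \<epsilon> / 2 \<le> mean_service_o N \<pi>p \<pi>o m j" for j
    using slack[of j] unfolding x_def y_def by linarith
  moreover have "allowed N j (x j, y j)" for j
    using nonneg[of j] by (simp add: allowed_def x_def y_def)
  ultimately have "sustainable x y (\<epsilon> / 2)"
    unfolding sustainable_def using \<epsilon> pol by (metis half_gt_zero)
  moreover have "average_utility N Ap Ao \<le> ereal (point_utility x y)"
  proof -
    have avg_max: "1 / real K * (\<Sum>k<K. expectation (Z k)) \<le> C"
      if "0 < K" "\<And>k. integrable M (Z k)" "\<And>k \<omega>. \<omega> \<in> space M \<Longrightarrow> Z k \<omega> \<le> C" for K C and Z :: "nat \<Rightarrow> 'w \<Rightarrow> real"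
    proof -
      have "expectation (Z k) \<le> C" for k
        using integral_mono[OF that(2)[of k] integrable_const that(3)] by (simp add: prob_space)
      then have "(\<Sum>k<K. expectation (Z k)) \<le> (\<Sum>k<K. C)" by (intro sum_mono)
      with that(1) show ?thesis by (simp add: divide_le_eq mult.commute)
    qed
    \<comment> \<open>Convergence alone does not put the averages below \<open>l j\<close>; the half
      of the slack that is given up also absorbs this error, for all nodes at once since there are
      finitely many.\<close>
    have ev: "\<forall>\<^sub>F K in sequentially. \<forall>j. 1 / real K * (\<Sum>k<K. expectation (\<lambda>\<omega>. A k \<omega> j)) < l j + \<epsilon> / 2"
      if "has_average_rate N A l" for A l
      using that \<epsilon> unfolding has_average_rate_def
      by (intro eventually_all_finite, elim allE, intro order_tendstoD(2)) auto
    from ev[OF rates(1)] ev[OF rates(2)]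
    have "\<forall>\<^sub>F K in sequentially. 1 / real K * (\<Sum>k<K. block_utility N (Ap k) (Ao k)) \<le> point_utility x y"
      using eventually_gt_at_top[of 0]
    proof eventually_elim
      case (elim K)
      have px: "1 / real K * (\<Sum>k<K. expectation (\<lambda>\<omega>. Ap k \<omega> j)) \<le> x j" for j
        using elim(1) avg_max[of K "\<lambda>k \<omega>. Ap k \<omega> j" "inj_max_p N j"] elim(3) I(4) D(4)
        unfolding x_def by (intro min.boundedI) (auto intro: less_imp_le)
      have oy: "1 / real K * (\<Sum>k<K. expectation (\<lambda>\<omega>. Ao k \<omega> j)) \<le> y j" for j
        using elim(2) avg_max[of K "\<lambda>k \<omega>. Ao k \<omega> j" "inj_max_o N j"] elim(3) I(5) D(5)
        unfolding y_def by (intro min.boundedI) (auto intro: less_imp_le)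
      have sumxy: "1 / real K * (\<Sum>k<K. expectation (\<lambda>\<omega>. Ap k \<omega> j + Ao k \<omega> j)) \<le> x j + y j" for j
        using add_mono[OF px[of j] oy[of j]] I(4,5) by (simp add: sum.distrib add_divide_distrib)
      have up: "1 / real K * (\<Sum>k<K. expectation (\<lambda>\<omega>. util_p N j (Ap k \<omega> j))) \<le> util_p N j (x j)" for j
        using D(4) nonneg(1) deg(1) elim(3) px
        by (intro average_concave_le[OF util_p(1,2) D(1), where C = "inj_max_p N j"])
      have uo: "1 / real K * (\<Sum>k<K. expectation (\<lambda>\<omega>. util_o N j (Ao k \<omega> j))) \<le> util_o N j (y j)" for j
        using D(5) nonneg(2) deg(2) elim(3) oy
        by (intro average_concave_le[OF util_o(1,2) D(2), where C = "inj_max_o N j"])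
      have upo: "1 / real K * (\<Sum>k<K. expectation (\<lambda>\<omega>. util_o N j (Ap k \<omega> j + Ao k \<omega> j)))
          \<le> util_o N j (x j + y j)" for j
      proof (intro average_concave_le[OF util_o(1,2) D(3), where C = "inj_max_p N j + inj_max_o N j"])
        show "inj_max_p N j + inj_max_o N j = 0" if "x j + y j = 0"
          using deg[of j] nonneg[of j] that by (simp add: add_nonneg_eq_0_iff)
      qed (use D(6) nonneg elim(3) sumxy in \<open>auto intro: add_nonneg_nonneg\<close>)
      have "1 / real K * (\<Sum>k<K. block_utility N (Ap k) (Ao k)) =
          (\<Sum>j\<in>UNIV. (1 - \<gamma> j) * (1 / real K * (\<Sum>k<K. expectation (\<lambda>\<omega>. util_p N j (Ap k \<omega> j)))) +
            (\<gamma> j * (1 / real K * (\<Sum>k<K. expectation (\<lambda>\<omega>. util_o N j (Ap k \<omega> j + Ao k \<omega> j)))) +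
             (1 - \<gamma> j) * (1 / real K * (\<Sum>k<K. expectation (\<lambda>\<omega>. util_o N j (Ao k \<omega> j))))))"
        unfolding block_utility_def exp_gp_def exp_go_def
        by (subst sum.swap) (simp add: sum.distrib sum_distrib_left mult.left_commute sum_divide_distrib add_divide_distrib)
      also have "\<dots> \<le> (\<Sum>j\<in>UNIV. (1 - \<gamma> j) * util_p N j (x j) +
            (\<gamma> j * util_o N j (x j + y j) + (1 - \<gamma> j) * util_o N j (y j)))"
        using tol by (intro sum_mono add_mono mult_left_mono up uo upo) (auto intro: less_imp_le)
      also have "\<dots> = point_utility x y"
        by (simp add: point_utility_def node_utility_def algebra_simps)
      finally show ?case .
    qed
    then have "limsup (\<lambda>K. ereal (1 / real K * (\<Sum>k<K. block_utility N (Ap k) (Ao k))))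
        \<le> ereal (point_utility x y)"
      by (intro Limsup_bounded) (auto elim: eventually_mono)
    then show ?thesis
      unfolding average_utility_def
      using Liminf_le_Limsup[of sequentially "\<lambda>K. ereal (1 / real K * (\<Sum>k<K. block_utility N (Ap k) (Ao k)))"]
      by simp
  qed
  ultimately show thesis by (rule that)
qed

end

section \<open>Queues under the control algorithm\<close>

text \<open>Truncation at 0 only decreases the square of \<open>q - r\<close>, and in the cross term
  with \<open>a\<close> the remaining queue is at most \<open>q\<close>.\<close>

lemma queue_drift:
  fixes q r a :: real
  assumes "0 \<le> q" "0 \<le> r" "0 \<le> a"
  shows "(max 0 (q - r) + a)\<^sup>2 \<le> q\<^sup>2 + r\<^sup>2 + a\<^sup>2 - 2 * q * (r - a)"
proof -
  have "(max 0 (q - r))\<^sup>2 \<le> (q - r)\<^sup>2"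
    by (auto simp: max_def)
  moreover have "max 0 (q - r) * a \<le> q * a"
    using assms by (intro mult_right_mono) auto
  ultimately show ?thesis
    by (simp add: power2_eq_square algebra_simps)
qed

text \<open>The recursion reaches only blocks before \<open>k\<close>, so \<open>Q k\<close> is
  known before the channel of block \<open>k\<close>. The linear growth bound ignores all service;
  it serves only to make the queue and its square integrable for each fixed
  \<open>k\<close>.\<close>

lemma (in wireless_network) queue_process:
  fixes Q R A :: "nat \<Rightarrow> 'w \<Rightarrow> real"
  assumes F: "\<And>k. subalgebra M (F k)" "\<And>k. sets (F k) \<subseteq> sets (F (Suc k))"
    and R: "\<And>k. R k \<in> borel_measurable (F (Suc k))" "\<And>k \<omega>. \<omega> \<in> space M \<Longrightarrow> 0 \<le> R k \<omega>"
    and A: "\<And>k. A k \<in> borel_measurable (F (Suc k))"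
      "\<And>k \<omega>. \<omega> \<in> space M \<Longrightarrow> 0 \<le> A k \<omega> \<and> A k \<omega> \<le> C"
    and Q0: "0 \<le> q" "\<And>\<omega>. \<omega> \<in> space M \<Longrightarrow> Q 0 \<omega> = q"
    and Q: "\<And>k \<omega>. \<omega> \<in> space M \<Longrightarrow> Q (Suc k) \<omega> = max 0 (Q k \<omega> - R k \<omega>) + A k \<omega>"
  shows "Q k \<in> borel_measurable (F k)"
    and "\<omega> \<in> space M \<Longrightarrow> 0 \<le> Q k \<omega> \<and> Q k \<omega> \<le> q + real k * C"
proof -
  have space: "space (F k) = space M" for k
    using F(1) by (simp add: subalgebra_def)
  show "Q k \<in> borel_measurable (F k)"
  proof (induction k)
    case 0
    have "Q 0 \<in> borel_measurable (F 0) \<longleftrightarrow> (\<lambda>_. q) \<in> borel_measurable (F 0)"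
      by (intro measurable_cong) (simp add: space Q0)
    then show ?case by simp
  next
    case (Suc k)
    have [measurable]: "Q k \<in> borel_measurable (F (Suc k))"
      using Suc F(2)[of k] by (auto simp: measurable_def space)
    note [measurable] = R(1)[of k] A(1)[of k]
    have "Q (Suc k) \<in> borel_measurable (F (Suc k))
        \<longleftrightarrow> (\<lambda>\<omega>. max 0 (Q k \<omega> - R k \<omega>) + A k \<omega>) \<in> borel_measurable (F (Suc k))"
      by (intro measurable_cong) (simp add: space Q)
    then show ?case by simp
  qed
  show "0 \<le> Q k \<omega> \<and> Q k \<omega> \<le> q + real k * C" if "\<omega> \<in> space M"
  proof (induction k)
    case 0
    then show ?case using Q0 that by simp
  next
    case (Suc k)
    have "max 0 (Q k \<omega> - R k \<omega>) \<le> Q k \<omega>"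
      using Suc R(2)[OF that, of k] by auto
    with Suc A(2)[OF that, of k] show ?case
      by (auto simp: Q[OF that] distrib_right)
  qed
qed

text \<open>Half the sum of the squared bounds on the two service rates and the two injections of
  every node. The summand 1 makes the constant positive even when all these bounds are 0.\<close>

definition (in wireless_network) drift_bound :: real where
  "drift_bound = (\<Sum>j\<in>UNIV. (2 * c\<^sup>2 + (inj_max_p N j)\<^sup>2 + (inj_max_o N j)\<^sup>2) / 2) + 1"

lemma (in wireless_network) drift_bound_pos: "0 < drift_bound"
  unfolding drift_bound_def by (intro add_nonneg_pos sum_nonneg) auto

locale controlled_network = wireless_network N c
  for N :: "('w, 'n::finite) net" and c :: real +
  fixes V :: real and Qp Qo Ap Ao Ip Io :: "nat \<Rightarrow> 'w \<Rightarrow> 'n \<Rightarrow> real"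
  assumes V_pos: "0 < V"
    and run: "runs_control_algorithm N V Qp Qo Ap Ao Ip Io"
begin

abbreviation Rp where "Rp k \<omega> j \<equiv> service_p (uplink N k \<omega> $ j) (rho k \<omega> j) (Ip k \<omega> j)"
abbreviation Ro where "Ro k \<omega> j \<equiv> service_o (uplink N k \<omega> $ j) (rho k \<omega> j) (Ip k \<omega> j) (Io k \<omega> j)"

lemma run_history:
  obtains H where "history N H"
    "\<And>k j. (\<lambda>\<omega>. Ap k \<omega> j) \<in> borel_measurable (H (Suc k))"
    "\<And>k j. (\<lambda>\<omega>. Ao k \<omega> j) \<in> borel_measurable (H (Suc k))"
    "\<And>k j. (\<lambda>\<omega>. Ip k \<omega> j) \<in> borel_measurable (H (Suc k))"
    "\<And>k j. (\<lambda>\<omega>. Io k \<omega> j) \<in> borel_measurable (H (Suc k))"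
  using run unfolding runs_control_algorithm_def by blast

lemma run_initial:
  obtains qp qo where "\<And>j. 0 \<le> qp j" "\<And>j. 0 \<le> qo j"
    "\<And>\<omega> j. \<omega> \<in> space M \<Longrightarrow> Qp 0 \<omega> j = qp j" "\<And>\<omega> j. \<omega> \<in> space M \<Longrightarrow> Qo 0 \<omega> j = qo j"
  using run unfolding runs_control_algorithm_def by blast

lemma run_step:
  assumes "\<omega> \<in> space M"
  shows "is_arg_max (\<lambda>(a, b). V * node_utility j a b - Qp k \<omega> j * a - Qo k \<omega> j * b)
      (allowed N j) (Ap k \<omega> j, Ao k \<omega> j)"
    and "is_arg_max (\<lambda>(ip, io). \<Sum>j\<in>UNIV.
        Qp k \<omega> j * service_p (uplink N k \<omega> $ j) (rho k \<omega> j) (ip j) +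
        Qo k \<omega> j * service_o (uplink N k \<omega> $ j) (rho k \<omega> j) (ip j) (io j))
      valid_mode (Ip k \<omega>, Io k \<omega>)"
    and "Qp (Suc k) \<omega> j = max 0 (Qp k \<omega> j - Rp k \<omega> j) + Ap k \<omega> j"
    and "Qo (Suc k) \<omega> j = max 0 (Qo k \<omega> j - Ro k \<omega> j) + Ao k \<omega> j"
  using run assms unfolding runs_control_algorithm_def node_utility_def Let_def by blast+

lemma injection_bounds:
  assumes "\<omega> \<in> space M"
  shows "0 \<le> Ap k \<omega> j \<and> Ap k \<omega> j \<le> inj_max_p N j" "0 \<le> Ao k \<omega> j \<and> Ao k \<omega> j \<le> inj_max_o N j"
  using run_step(1)[OF assms, where j = j and k = k] by (auto simp: is_arg_max_def allowed_def)

text \<open>A node is never in both modes at once. In the joint mode the two rates add up to the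
  uplink rate, and a nonnegative margin keeps the private part below it, so the open part is
  nonnegative.\<close>

lemma service_bounds:
  assumes \<omega>: "\<omega> \<in> space M"
  shows "0 \<le> Rp k \<omega> j \<and> Rp k \<omega> j \<le> c" "0 \<le> Ro k \<omega> j \<and> Ro k \<omega> j \<le> c"
proof -
  have valid: "valid_mode (Ip k \<omega>, Io k \<omega>)"
    using run_step(2)[OF \<omega>, where k = k] by (simp add: is_arg_max_def)
  then have bin: "Ip k \<omega> i \<in> {0, 1}" "Io k \<omega> i \<in> {0, 1}" for i
    by (simp_all add: valid_mode_def)
  have "Ip k \<omega> j + Io k \<omega> j \<le> (\<Sum>i\<in>UNIV. Ip k \<omega> i + Io k \<omega> i)"
  proof (rule member_le_sum)
    show "0 \<le> Ip k \<omega> i + Io k \<omega> i" for i using bin[of i] by auto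
  qed auto
  also have "\<dots> \<le> 1" using valid by (simp add: valid_mode_def)
  finally have one: "Ip k \<omega> j + Io k \<omega> j \<le> 1" .
  show "0 \<le> Rp k \<omega> j \<and> Rp k \<omega> j \<le> c" "0 \<le> Ro k \<omega> j \<and> Ro k \<omega> j \<le> c"
    using bin[of j] one uplink_nonneg[OF \<omega>, where k = k and j = j] uplink_le[OF \<omega>, where k = k and j = j]
      margin_nonneg[OF \<omega>, where k = k and j = j]
    by (auto simp: service_p_def service_o_def max_def)
qed

lemma injections_admissible: "admissible N (Ap k) (Ao k)"
proof -
  obtain H where H: "history N H"
    "\<And>k j. (\<lambda>\<omega>. Ap k \<omega> j) \<in> borel_measurable (H (Suc k))"
    "\<And>k j. (\<lambda>\<omega>. Ao k \<omega> j) \<in> borel_measurable (H (Suc k))"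
    by (rule run_history) blast
  then have sub: "subalgebra M (H (Suc k))" by (simp add: history_def)
  show ?thesis
    unfolding admissible_def
  proof (intro allI conjI ballI)
    fix j
    show "(\<lambda>\<omega>. Ap k \<omega> j) \<in> borel_measurable M" "(\<lambda>\<omega>. Ao k \<omega> j) \<in> borel_measurable M"
      using H(2,3) by (auto intro: measurable_from_subalg[OF sub])
    show "allowed N j (Ap k \<omega> j, Ao k \<omega> j)" if "\<omega> \<in> space M" for \<omega>
      using injection_bounds[OF that] by (simp add: allowed_def)
  qed
qed

text \<open>The history is returned together with the queue properties, since the argument needs one
  and the same \<open>H\<close> for the measurability of the queues and for independence of the
  channel.\<close>

lemma queues:
  obtains H qp qo where "history N H"
    "\<And>k j. (\<lambda>\<omega>. Qp k \<omega> j) \<in> borel_measurable (H k)"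
    "\<And>k j. (\<lambda>\<omega>. Qo k \<omega> j) \<in> borel_measurable (H k)"
    "\<And>k j \<omega>. \<omega> \<in> space M \<Longrightarrow> 0 \<le> Qp k \<omega> j \<and> Qp k \<omega> j \<le> qp j + real k * inj_max_p N j"
    "\<And>k j \<omega>. \<omega> \<in> space M \<Longrightarrow> 0 \<le> Qo k \<omega> j \<and> Qo k \<omega> j \<le> qo j + real k * inj_max_o N j"
proof -
  obtain H where H: "history N H"
    and meas: "\<And>k j. (\<lambda>\<omega>. Ap k \<omega> j) \<in> borel_measurable (H (Suc k))"
    "\<And>k j. (\<lambda>\<omega>. Ao k \<omega> j) \<in> borel_measurable (H (Suc k))"
    "\<And>k j. (\<lambda>\<omega>. Ip k \<omega> j) \<in> borel_measurable (H (Suc k))"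
    "\<And>k j. (\<lambda>\<omega>. Io k \<omega> j) \<in> borel_measurable (H (Suc k))"
    by (rule run_history) blast
  obtain qp qo where q: "\<And>j. 0 \<le> qp j" "\<And>j. 0 \<le> qo j"
    "\<And>\<omega> j. \<omega> \<in> space M \<Longrightarrow> Qp 0 \<omega> j = qp j" "\<And>\<omega> j. \<omega> \<in> space M \<Longrightarrow> Qo 0 \<omega> j = qo j"
    by (rule run_initial) blast
  from H have F: "\<And>k. subalgebra M (H k)" "\<And>k. sets (H k) \<subseteq> sets (H (Suc k))"
    and ch: "\<And>k. channel_state N k \<in> borel_measurable (H (Suc k))"
    by (auto simp: history_def)
  have [measurable]: "(\<lambda>\<omega>. rho k \<omega> j) \<in> borel_measurable (H (Suc k))"
    "(\<lambda>\<omega>. uplink N k \<omega> $ j) \<in> borel_measurable (H (Suc k))" for k j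
    using F(1)[of "Suc k"] ch[of k]
    by (auto intro: margin_measurable uplink_measurable simp: subalgebra_def)
  note [measurable] = meas
  have Rmeas: "(\<lambda>\<omega>. Rp k \<omega> j) \<in> borel_measurable (H (Suc k))" "(\<lambda>\<omega>. Ro k \<omega> j) \<in> borel_measurable (H (Suc k))" for k j
    unfolding service_p_def service_o_def by measurable
  note P = queue_process[of H "\<lambda>k \<omega>. Rp k \<omega> j" "\<lambda>k \<omega>. Ap k \<omega> j" "inj_max_p N j" "qp j" "\<lambda>k \<omega>. Qp k \<omega> j" for j,
      OF F Rmeas(1) _ meas(1) injection_bounds(1) q(1,3) run_step(3)]
  note O = queue_process[of H "\<lambda>k \<omega>. Ro k \<omega> j" "\<lambda>k \<omega>. Ao k \<omega> j" "inj_max_o N j" "qo j" "\<lambda>k \<omega>. Qo k \<omega> j" for j,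
      OF F Rmeas(2) _ meas(2) injection_bounds(2) q(2,4) run_step(4)]
  show thesis
  proof (rule that[OF H])
    show "(\<lambda>\<omega>. Qp k \<omega> j) \<in> borel_measurable (H k)" for k j
      using service_bounds(1) by (intro P(1)) auto
    show "(\<lambda>\<omega>. Qo k \<omega> j) \<in> borel_measurable (H k)" for k j
      using service_bounds(2) by (intro O(1)) auto
    show "0 \<le> Qp k \<omega> j \<and> Qp k \<omega> j \<le> qp j + real k * inj_max_p N j" if "\<omega> \<in> space M" for k j \<omega>
      using service_bounds(1) that by (intro P(2)) auto
    show "0 \<le> Qo k \<omega> j \<and> Qo k \<omega> j \<le> qo j + real k * inj_max_o N j" if "\<omega> \<in> space M" for k j \<omega>
      using service_bounds(2) that by (intro O(2)) auto
  qed
qed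

lemma queue_nonneg: "\<omega> \<in> space M \<Longrightarrow> 0 \<le> Qp k \<omega> j" "\<omega> \<in> space M \<Longrightarrow> 0 \<le> Qo k \<omega> j"
  by (rule queues, blast)+

lemma queue_integrable:
  "integrable M (\<lambda>\<omega>. Qp k \<omega> j)" "integrable M (\<lambda>\<omega>. Qo k \<omega> j)"
  "integrable M (\<lambda>\<omega>. (Qp k \<omega> j)\<^sup>2)" "integrable M (\<lambda>\<omega>. (Qo k \<omega> j)\<^sup>2)"
proof -
  obtain H qp qo where H: "history N H"
    and meas: "(\<lambda>\<omega>. Qp k \<omega> j) \<in> borel_measurable (H k)" "(\<lambda>\<omega>. Qo k \<omega> j) \<in> borel_measurable (H k)"
    and bounds: "\<And>\<omega>. \<omega> \<in> space M \<Longrightarrow> 0 \<le> Qp k \<omega> j \<and> Qp k \<omega> j \<le> qp j + real k * inj_max_p N j"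
    "\<And>\<omega>. \<omega> \<in> space M \<Longrightarrow> 0 \<le> Qo k \<omega> j \<and> Qo k \<omega> j \<le> qo j + real k * inj_max_o N j"
    by (rule queues) blast
  from H have sub: "subalgebra M (H k)" by (simp add: history_def)
  note [measurable] = measurable_from_subalg[OF sub meas(1)] measurable_from_subalg[OF sub meas(2)]
  show "integrable M (\<lambda>\<omega>. Qp k \<omega> j)"
    by (rule integrable_bounded[where C = "qp j + real k * inj_max_p N j"]) (use bounds(1) in auto)
  show "integrable M (\<lambda>\<omega>. Qo k \<omega> j)"
    by (rule integrable_bounded[where C = "qo j + real k * inj_max_o N j"]) (use bounds(2) in auto)
  show "integrable M (\<lambda>\<omega>. (Qp k \<omega> j)\<^sup>2)"
    by (rule integrable_bounded[where C = "(qp j + real k * inj_max_p N j)\<^sup>2"])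
      (use bounds(1) in \<open>auto intro: power_mono\<close>)
  show "integrable M (\<lambda>\<omega>. (Qo k \<omega> j)\<^sup>2)"
    by (rule integrable_bounded[where C = "(qo j + real k * inj_max_o N j)\<^sup>2"])
      (use bounds(2) in \<open>auto intro: power_mono\<close>)
qed

text \<open>Independence splits the product within block \<open>k\<close>; identical distribution
  then moves the channel factor to block 0, where the mean service rates are defined.\<close>

lemma expectation_queue_channel:
  fixes f :: "(real ^ 'n) \<times> (real ^ 'n ^ 'n) \<times> (real ^ 'n ^ 'n) \<Rightarrow> real"
  assumes f: "f \<in> borel_measurable borel"
    and bound: "\<And>k \<omega>. \<omega> \<in> space M \<Longrightarrow> \<bar>f (channel_state N k \<omega>)\<bar> \<le> C"
  shows "expectation (\<lambda>\<omega>. Qp k \<omega> j * f (channel_state N k \<omega>))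
      = expectation (\<lambda>\<omega>. Qp k \<omega> j) * expectation (\<lambda>\<omega>. f (channel_state N 0 \<omega>))"
    and "integrable M (\<lambda>\<omega>. Qp k \<omega> j * f (channel_state N k \<omega>))"
    and "expectation (\<lambda>\<omega>. Qo k \<omega> j * f (channel_state N k \<omega>))
      = expectation (\<lambda>\<omega>. Qo k \<omega> j) * expectation (\<lambda>\<omega>. f (channel_state N 0 \<omega>))"
    and "integrable M (\<lambda>\<omega>. Qo k \<omega> j * f (channel_state N k \<omega>))"
proof -
  obtain H where H: "history N H"
    and meas: "(\<lambda>\<omega>. Qp k \<omega> j) \<in> borel_measurable (H k)" "(\<lambda>\<omega>. Qo k \<omega> j) \<in> borel_measurable (H k)"
    by (rule queues) blast
  from H have sub: "subalgebra M (H k)"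
    and indep: "indep_set (sets (H k)) (sets (vimage_algebra (space M) (channel_state N k) borel))"
    by (auto simp: history_def)
  have int: "integrable M (\<lambda>\<omega>. f (channel_state N k \<omega>))"
    using measurable_compose[OF channel_measurable f] bound by (rule integrable_bounded)
  have "expectation (\<lambda>\<omega>. f (channel_state N k \<omega>)) = integral\<^sup>L (distr M borel (channel_state N k)) f"
    using f channel_measurable by (simp add: integral_distr)
  also have "\<dots> = expectation (\<lambda>\<omega>. f (channel_state N 0 \<omega>))"
    using f channel_measurable by (subst channel_distr) (simp add: integral_distr)
  finally have eq: "expectation (\<lambda>\<omega>. f (channel_state N k \<omega>)) = expectation (\<lambda>\<omega>. f (channel_state N 0 \<omega>))" .
  note P = expectation_mult_indep[OF sub meas(1) channel_measurable f indep queue_integrable(1) int]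
  note O = expectation_mult_indep[OF sub meas(2) channel_measurable f indep queue_integrable(2) int]
  from P(1) O(1) show "expectation (\<lambda>\<omega>. Qp k \<omega> j * f (channel_state N k \<omega>))
      = expectation (\<lambda>\<omega>. Qp k \<omega> j) * expectation (\<lambda>\<omega>. f (channel_state N 0 \<omega>))"
    "expectation (\<lambda>\<omega>. Qo k \<omega> j * f (channel_state N k \<omega>))
      = expectation (\<lambda>\<omega>. Qo k \<omega> j) * expectation (\<lambda>\<omega>. f (channel_state N 0 \<omega>))"
    by (simp_all only: eq)
  from P(2) O(2) show "integrable M (\<lambda>\<omega>. Qp k \<omega> j * f (channel_state N k \<omega>))"
    "integrable M (\<lambda>\<omega>. Qo k \<omega> j * f (channel_state N k \<omega>))" .
qed

end

section \<open>Drift plus penalty\<close>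

text \<open>The mean private rate of a randomised policy given the observation, written as a
  function of the full channel state. In this form independence and identical distribution of
  \<open>channel_state\<close> apply directly, although the cross-channel rates are ignored.\<close>

definition policy_rate_p ::
    "('n::finite \<Rightarrow> (real ^ 'n) \<times> (real ^ 'n ^ 'n) \<Rightarrow> real) \<Rightarrow>
     ('n::finite \<Rightarrow> (real ^ 'n) \<times> (real ^ 'n ^ 'n) \<Rightarrow> real) \<Rightarrow>
     'n \<Rightarrow>
     (real ^ 'n) \<times> (real ^ 'n ^ 'n) \<times> (real ^ 'n ^ 'n) \<Rightarrow> real" where
  "policy_rate_p \<pi>p m j s =
     \<pi>p j (fst s, snd (snd s)) * service_p (fst s $ j) (m j (fst s, snd (snd s))) 1"

definition policy_rate_o ::
    "('n::finite \<Rightarrow> (real ^ 'n) \<times> (real ^ 'n ^ 'n) \<Rightarrow> real) \<Rightarrow>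
     ('n::finite \<Rightarrow> (real ^ 'n) \<times> (real ^ 'n ^ 'n) \<Rightarrow> real) \<Rightarrow>
     ('n::finite \<Rightarrow> (real ^ 'n) \<times> (real ^ 'n ^ 'n) \<Rightarrow> real) \<Rightarrow>
     'n \<Rightarrow>
     (real ^ 'n) \<times> (real ^ 'n ^ 'n) \<times> (real ^ 'n ^ 'n) \<Rightarrow> real" where
  "policy_rate_o \<pi>p \<pi>o m j s =
     \<pi>p j (fst s, snd (snd s)) * service_o (fst s $ j) (m j (fst s, snd (snd s))) 1 0 +
     \<pi>o j (fst s, snd (snd s)) * service_o (fst s $ j) (m j (fst s, snd (snd s))) 0 1"

context wireless_network
begin

lemma policy_rate_mean:
  "expectation (\<lambda>\<omega>. policy_rate_p \<pi>p m j (channel_state N 0 \<omega>)) = mean_service_p N \<pi>p m j"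
  "expectation (\<lambda>\<omega>. policy_rate_o \<pi>p \<pi>o m j (channel_state N 0 \<omega>)) = mean_service_o N \<pi>p \<pi>o m j"
  by (simp_all add: policy_rate_p_def policy_rate_o_def mean_service_p_def mean_service_o_def
      channel_state_def observation_def)

lemma policy_rate_measurable:
  assumes "stationary_policy N \<pi>p \<pi>o m"
  shows "policy_rate_p \<pi>p m j \<in> borel_measurable borel" "policy_rate_o \<pi>p \<pi>o m j \<in> borel_measurable borel"
proof -
  have obs: "(\<lambda>s::(real^'n) \<times> (real^'n^'n) \<times> (real^'n^'n). (fst s, snd (snd s))) \<in> borel_measurable borel"
    and [measurable]: "(\<lambda>s::(real^'n) \<times> (real^'n^'n) \<times> (real^'n^'n). fst s $ j) \<in> borel_measurable borel"
    by (intro borel_measurable_continuous_onI continuous_intros)+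
  have "\<pi>p j \<in> borel_measurable borel" "\<pi>o j \<in> borel_measurable borel" "m j \<in> borel_measurable borel"
    using assms unfolding stationary_policy_def by blast+
  note [measurable] = this[THEN measurable_compose[OF obs]]
  show "policy_rate_p \<pi>p m j \<in> borel_measurable borel" "policy_rate_o \<pi>p \<pi>o m j \<in> borel_measurable borel"
    unfolding policy_rate_p_def[abs_def] policy_rate_o_def[abs_def] service_p_def service_o_def
    by measurable
qed

lemma policy_prob_bounds:
  assumes "stationary_policy N \<pi>p \<pi>o m"
  shows "0 \<le> \<pi>p j s" "0 \<le> \<pi>o j s" "(\<Sum>j\<in>UNIV. \<pi>p j s + \<pi>o j s) \<le> 1" "\<pi>p j s \<le> 1" "\<pi>o j s \<le> 1"
proof -
  show *: "0 \<le> \<pi>p j s" "0 \<le> \<pi>o j s" for j and s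
    using assms unfolding stationary_policy_def by blast+
  show sum: "(\<Sum>j\<in>UNIV. \<pi>p j s + \<pi>o j s) \<le> 1"
    using assms unfolding stationary_policy_def by blast
  have "\<pi>p j s + \<pi>o j s \<le> (\<Sum>j\<in>UNIV. \<pi>p j s + \<pi>o j s)"
    by (rule member_le_sum) (auto simp: *)
  with sum *[of j s] show "\<pi>p j s \<le> 1" "\<pi>o j s \<le> 1" by linarith+
qed

lemma policy_margin:
  assumes "stationary_policy N \<pi>p \<pi>o m" "\<omega> \<in> space M"
  shows "0 \<le> m j (observation N k \<omega>)" "rho k \<omega> j \<le> m j (observation N k \<omega>)"
proof -
  have "p_out N j (est j k \<omega>) (m j (observation N k \<omega>)) = \<gamma> j"
    using assms unfolding stationary_policy_def by blast
  then show "0 \<le> m j (observation N k \<omega>)" "rho k \<omega> j \<le> m j (observation N k \<omega>)"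
    using solution_nonneg[OF assms(2)] margin_le[OF assms(2)] by blast+
qed

text \<open>The two modes contribute to the open rate at most \<open>c\<close> each. The crude
  factor 2 is harmless because the bound is used only for integrability.\<close>

lemma policy_rate_bounded:
  assumes pol: "stationary_policy N \<pi>p \<pi>o m" and \<omega>: "\<omega> \<in> space M"
  shows "\<bar>policy_rate_p \<pi>p m j (channel_state N k \<omega>)\<bar> \<le> 2 * c"
    "\<bar>policy_rate_o \<pi>p \<pi>o m j (channel_state N k \<omega>)\<bar> \<le> 2 * c"
proof -
  have prod: "0 \<le> p * r \<and> p * r \<le> c" if "0 \<le> p" "p \<le> 1" "0 \<le> r" "r \<le> c" for p r
    using mult_mono[of p 1 r c] that rate_bound_nonneg by simp
  note B = policy_prob_bounds[OF pol] and m = policy_margin(1)[OF pol \<omega>, where k = k and j = j]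
  note r = uplink_nonneg[OF \<omega>, where k = k and j = j] uplink_le[OF \<omega>, where k = k and j = j]
  let ?s = "observation N k \<omega>" and ?r = "uplink N k \<omega> $ j"
  have p: "0 \<le> \<pi>p j ?s * service_p ?r (m j ?s) 1 \<and> \<pi>p j ?s * service_p ?r (m j ?s) 1 \<le> c"
    using r m by (intro prod B) (auto simp: service_p_def)
  have o1: "0 \<le> \<pi>p j ?s * service_o ?r (m j ?s) 1 0 \<and> \<pi>p j ?s * service_o ?r (m j ?s) 1 0 \<le> c"
    using r m by (intro prod B) (auto simp: service_o_def service_p_def)
  have o2: "0 \<le> \<pi>o j ?s * service_o ?r (m j ?s) 0 1 \<and> \<pi>o j ?s * service_o ?r (m j ?s) 0 1 \<le> c"
    using r m by (intro prod B) (auto simp: service_o_def service_p_def)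
  have eq: "policy_rate_p \<pi>p m j (channel_state N k \<omega>) = \<pi>p j ?s * service_p ?r (m j ?s) 1"
    "policy_rate_o \<pi>p \<pi>o m j (channel_state N k \<omega>)
      = \<pi>p j ?s * service_o ?r (m j ?s) 1 0 + \<pi>o j ?s * service_o ?r (m j ?s) 0 1"
    by (simp_all add: policy_rate_p_def policy_rate_o_def observation_def channel_state_def)
  show "\<bar>policy_rate_p \<pi>p m j (channel_state N k \<omega>)\<bar> \<le> 2 * c"
    using p by (simp add: eq)
  show "\<bar>policy_rate_o \<pi>p \<pi>o m j (channel_state N k \<omega>)\<bar> \<le> 2 * c"
    using o1 o2 by (simp add: eq)
qed

end

context controlled_network
begin

lemma schedule_ge_mode:
  assumes \<omega>: "\<omega> \<in> space M" and valid: "valid_mode (ip, io)"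
  shows "(\<Sum>j\<in>UNIV. Qp k \<omega> j * service_p (uplink N k \<omega> $ j) (rho k \<omega> j) (ip j) +
        Qo k \<omega> j * service_o (uplink N k \<omega> $ j) (rho k \<omega> j) (ip j) (io j))
    \<le> (\<Sum>j\<in>UNIV. Qp k \<omega> j * Rp k \<omega> j + Qo k \<omega> j * Ro k \<omega> j)"
  using run_step(2)[OF \<omega>, where k = k] valid by (fastforce simp: is_arg_max_def not_less)

text \<open>In the joint mode the two service rates add up to the uplink rate. Hence a margin larger than
  necessary only helps if \<open>Qp \<le> Qo\<close>, and then the open mode is at least as good.\<close>

lemma schedule_ge_policy:
  assumes \<omega>: "\<omega> \<in> space M" and pol: "stationary_policy N \<pi>p \<pi>o m"
  shows "(\<Sum>j\<in>UNIV. Qp k \<omega> j * policy_rate_p \<pi>p m j (channel_state N k \<omega>) +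
        Qo k \<omega> j * policy_rate_o \<pi>p \<pi>o m j (channel_state N k \<omega>))
    \<le> (\<Sum>j\<in>UNIV. Qp k \<omega> j * Rp k \<omega> j + Qo k \<omega> j * Ro k \<omega> j)" (is "_ \<le> ?W")
proof -
  let ?s = "observation N k \<omega>" and ?r = "\<lambda>j. uplink N k \<omega> $ j"
  note Q = queue_nonneg[OF \<omega>] and B = policy_prob_bounds[OF pol]
  \<comment> \<open>A randomised policy is a mixture of silence and of single nodes in one mode, so
    comparing the scheduler with these pure modes is enough.\<close>
  have single: "valid_mode (\<lambda>i. if i = j then 1 else 0, \<lambda>_. 0)"
    "valid_mode (\<lambda>_. 0, \<lambda>i. if i = j then 1 else 0)" for j :: 'n
    by (simp_all add: valid_mode_def)
  \<comment> \<open>Silence has weight 0, so the maximal weight is nonnegative; this covers policies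
    whose probabilities sum to less than 1.\<close>
  have zero: "valid_mode (\<lambda>_::'n. 0, \<lambda>_. 0)" by (simp add: valid_mode_def)
  have W0: "0 \<le> ?W"
    using schedule_ge_mode[OF \<omega> zero, where k = k] by (simp add: service_p_def service_o_def)
  have Wo: "Qo k \<omega> j * ?r j \<le> ?W" for j
  proof -
    have "(\<Sum>i\<in>UNIV. Qp k \<omega> i * service_p (?r i) (rho k \<omega> i) 0 +
        Qo k \<omega> i * service_o (?r i) (rho k \<omega> i) 0 (if i = j then 1 else 0))
      = (\<Sum>i\<in>UNIV. if i = j then Qo k \<omega> j * ?r j else 0)"
      by (intro sum.cong) (auto simp: service_p_def service_o_def)
    with schedule_ge_mode[OF \<omega> single(2)[of j], where k = k] show ?thesis by simp
  qed
  have Wp: "Qp k \<omega> j * max 0 (?r j - rho k \<omega> j) + Qo k \<omega> j * (?r j - max 0 (?r j - rho k \<omega> j)) \<le> ?W" for j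
  proof -
    have "(\<Sum>i\<in>UNIV. Qp k \<omega> i * service_p (?r i) (rho k \<omega> i) (if i = j then 1 else 0) +
        Qo k \<omega> i * service_o (?r i) (rho k \<omega> i) (if i = j then 1 else 0) 0)
      = (\<Sum>i\<in>UNIV. if i = j then Qp k \<omega> j * max 0 (?r j - rho k \<omega> j)
          + Qo k \<omega> j * (?r j - max 0 (?r j - rho k \<omega> j)) else 0)"
      by (intro sum.cong) (auto simp: service_p_def service_o_def)
    with schedule_ge_mode[OF \<omega> single(1)[of j], where k = k] show ?thesis by simp
  qed
  have Wm: "Qp k \<omega> j * max 0 (?r j - m j ?s) + Qo k \<omega> j * (?r j - max 0 (?r j - m j ?s)) \<le> ?W" for j
  proof -
    let ?a = "max 0 (?r j - m j ?s)" and ?b = "max 0 (?r j - rho k \<omega> j)"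
    have ab: "0 \<le> ?a" "?a \<le> ?b"
      using policy_margin(2)[OF pol \<omega>, where k = k and j = j] by auto
    show ?thesis
    proof (cases "Qo k \<omega> j \<le> Qp k \<omega> j")
      case True
      then have "(Qp k \<omega> j - Qo k \<omega> j) * ?a \<le> (Qp k \<omega> j - Qo k \<omega> j) * ?b"
        using ab by (intro mult_left_mono) auto
      with Wp[of j] show ?thesis by (simp add: algebra_simps)
    next
      case False
      then have "(Qp k \<omega> j - Qo k \<omega> j) * ?a \<le> 0"
        using ab by (intro mult_nonpos_nonneg) auto
      with Wo[of j] show ?thesis by (simp add: algebra_simps)
    qed
  qed
  have "(\<Sum>j\<in>UNIV. Qp k \<omega> j * policy_rate_p \<pi>p m j (channel_state N k \<omega>) +
        Qo k \<omega> j * policy_rate_o \<pi>p \<pi>o m j (channel_state N k \<omega>))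
    = (\<Sum>j\<in>UNIV. \<pi>p j ?s * (Qp k \<omega> j * max 0 (?r j - m j ?s) + Qo k \<omega> j * (?r j - max 0 (?r j - m j ?s)))
        + \<pi>o j ?s * (Qo k \<omega> j * ?r j))"
    by (intro sum.cong)
      (auto simp: policy_rate_p_def policy_rate_o_def channel_state_def observation_def
        service_p_def service_o_def algebra_simps)
  also have "\<dots> \<le> (\<Sum>j\<in>UNIV. \<pi>p j ?s * ?W + \<pi>o j ?s * ?W)"
    by (intro sum_mono add_mono mult_left_mono Wm Wo B)
  also have "\<dots> = (\<Sum>j\<in>UNIV. \<pi>p j ?s + \<pi>o j ?s) * ?W"
    unfolding sum_distrib_right by (simp only: distrib_right)
  also have "\<dots> \<le> 1 * ?W"
    by (intro mult_right_mono B W0)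
  finally show ?thesis by simp
qed

lemma flow_ge_point:
  assumes \<omega>: "\<omega> \<in> space M" and "\<And>j. allowed N j (x j, y j)"
  shows "V * point_utility x y - (\<Sum>j\<in>UNIV. Qp k \<omega> j * x j + Qo k \<omega> j * y j)
    \<le> V * point_utility (Ap k \<omega>) (Ao k \<omega>) - (\<Sum>j\<in>UNIV. Qp k \<omega> j * Ap k \<omega> j + Qo k \<omega> j * Ao k \<omega> j)"
proof -
  have "V * node_utility j (x j) (y j) - Qp k \<omega> j * x j - Qo k \<omega> j * y j
      \<le> V * node_utility j (Ap k \<omega> j) (Ao k \<omega> j) - Qp k \<omega> j * Ap k \<omega> j - Qo k \<omega> j * Ao k \<omega> j" for j
    using run_step(1)[OF \<omega>, where k = k and j = j] assms(2)[of j]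
    by (auto simp: is_arg_max_def not_less)
  then have "(\<Sum>j\<in>UNIV. V * node_utility j (x j) (y j) - Qp k \<omega> j * x j - Qo k \<omega> j * y j)
      \<le> (\<Sum>j\<in>UNIV. V * node_utility j (Ap k \<omega> j) (Ao k \<omega> j) - Qp k \<omega> j * Ap k \<omega> j - Qo k \<omega> j * Ao k \<omega> j)"
    by (intro sum_mono)
  then show ?thesis
    by (simp add: point_utility_def sum_distrib_left sum_subtractf sum.distrib)
qed

abbreviation lyapunov :: "nat \<Rightarrow> 'w \<Rightarrow> real" where
  "lyapunov k \<omega> \<equiv> (\<Sum>j\<in>UNIV. (Qp k \<omega> j)\<^sup>2 + (Qo k \<omega> j)\<^sup>2)"

abbreviation backlog :: "nat \<Rightarrow> real" where
  "backlog k \<equiv> (\<Sum>j\<in>UNIV. expectation (\<lambda>\<omega>. Qp k \<omega> j) + expectation (\<lambda>\<omega>. Qo k \<omega> j))"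

lemma lyapunov_drift:
  assumes \<omega>: "\<omega> \<in> space M"
  shows "lyapunov (Suc k) \<omega> \<le> lyapunov k \<omega> + 2 * drift_bound
    - 2 * ((\<Sum>j\<in>UNIV. Qp k \<omega> j * Rp k \<omega> j + Qo k \<omega> j * Ro k \<omega> j)
         - (\<Sum>j\<in>UNIV. Qp k \<omega> j * Ap k \<omega> j + Qo k \<omega> j * Ao k \<omega> j))"
proof -
  let ?p = "\<lambda>j. inj_max_p N j" and ?o = "\<lambda>j. inj_max_o N j"
  have "(Qp (Suc k) \<omega> j)\<^sup>2 + (Qo (Suc k) \<omega> j)\<^sup>2 \<le>
      ((Qp k \<omega> j)\<^sup>2 + (Qo k \<omega> j)\<^sup>2) + (2 * c\<^sup>2 + (?p j)\<^sup>2 + (?o j)\<^sup>2)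
      - 2 * (Qp k \<omega> j * Rp k \<omega> j + Qo k \<omega> j * Ro k \<omega> j)
      + 2 * (Qp k \<omega> j * Ap k \<omega> j + Qo k \<omega> j * Ao k \<omega> j)" for j
  proof -
    note I = injection_bounds[OF \<omega>, where k = k and j = j] and S = service_bounds[OF \<omega>, where k = k and j = j]
    have "(Qp (Suc k) \<omega> j)\<^sup>2 \<le> (Qp k \<omega> j)\<^sup>2 + (Rp k \<omega> j)\<^sup>2 + (Ap k \<omega> j)\<^sup>2 - 2 * Qp k \<omega> j * (Rp k \<omega> j - Ap k \<omega> j)"
      unfolding run_step(3)[OF \<omega>] using I S queue_nonneg[OF \<omega>] by (intro queue_drift) auto
    moreover have "(Qo (Suc k) \<omega> j)\<^sup>2 \<le> (Qo k \<omega> j)\<^sup>2 + (Ro k \<omega> j)\<^sup>2 + (Ao k \<omega> j)\<^sup>2 - 2 * Qo k \<omega> j * (Ro k \<omega> j - Ao k \<omega> j)"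
      unfolding run_step(4)[OF \<omega>] using I S queue_nonneg[OF \<omega>] by (intro queue_drift) auto
    moreover have "(Rp k \<omega> j)\<^sup>2 \<le> c\<^sup>2" "(Ro k \<omega> j)\<^sup>2 \<le> c\<^sup>2" "(Ap k \<omega> j)\<^sup>2 \<le> (?p j)\<^sup>2" "(Ao k \<omega> j)\<^sup>2 \<le> (?o j)\<^sup>2"
      using I S by (auto intro!: power_mono)
    ultimately show ?thesis by (simp add: algebra_simps)
  qed
  then have "lyapunov (Suc k) \<omega> \<le> (\<Sum>j\<in>UNIV.
      ((Qp k \<omega> j)\<^sup>2 + (Qo k \<omega> j)\<^sup>2) + (2 * c\<^sup>2 + (?p j)\<^sup>2 + (?o j)\<^sup>2)
      - 2 * (Qp k \<omega> j * Rp k \<omega> j + Qo k \<omega> j * Ro k \<omega> j)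
      + 2 * (Qp k \<omega> j * Ap k \<omega> j + Qo k \<omega> j * Ao k \<omega> j))"
    by (rule sum_mono)
  also have "\<dots> = lyapunov k \<omega> + (\<Sum>j\<in>UNIV. 2 * c\<^sup>2 + (?p j)\<^sup>2 + (?o j)\<^sup>2)
      - 2 * (\<Sum>j\<in>UNIV. Qp k \<omega> j * Rp k \<omega> j + Qo k \<omega> j * Ro k \<omega> j)
      + 2 * (\<Sum>j\<in>UNIV. Qp k \<omega> j * Ap k \<omega> j + Qo k \<omega> j * Ao k \<omega> j)"
    by (simp only: sum.distrib sum_subtractf sum_distrib_left distrib_left)
  also have "(\<Sum>j\<in>UNIV. 2 * c\<^sup>2 + (?p j)\<^sup>2 + (?o j)\<^sup>2) \<le> 2 * drift_bound"
    by (simp add: drift_bound_def sum_divide_distrib[symmetric])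
  finally show ?thesis by simp
qed

end

section \<open>Time averages\<close>

text \<open>Division of the telescoped drift by \<open>2 * V * K\<close>: \<open>L\<close> is the
  initial Lyapunov value, \<open>G\<close> the utility of the competitor and \<open>X\<close> the
  sum of the block utilities. The contribution of \<open>L\<close> vanishes as \<open>K\<close>
  grows.\<close>

lemma utility_average_arith:
  fixes K V L B G X :: real
  assumes "0 < K" "0 < V" "0 \<le> L + 2 * K * (B - V * G) + 2 * V * X"
  shows "G - B / V - L / (2 * V) / K \<le> 1 / K * X"
proof -
  have "0 \<le> (L + 2 * K * (B - V * G) + 2 * V * X) / (2 * V * K)"
    using assms by simp
  also have "\<dots> = 1 / K * X - (G - B / V - L / (2 * V) / K)"
    using assms(1,2) by (simp add: field_simps)
  finally show ?thesis by simp
qed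

text \<open>Here \<open>X\<close> is the accumulated backlog, and every block utility has already
  been replaced by its upper bound \<open>b\<close>.\<close>

lemma queue_average_arith:
  fixes K V L B G X b \<delta> :: real
  assumes "0 < K" "0 < \<delta>" "2 * \<delta> * X \<le> L + 2 * K * (B - V * G) + 2 * V * (K * b)"
  shows "1 / K * X \<le> (B + V * (b - G)) / \<delta> + L / (2 * \<delta>) / K"
proof -
  have "2 * \<delta> * X / (2 * \<delta> * K) \<le> (L + 2 * K * (B - V * G) + 2 * V * (K * b)) / (2 * \<delta> * K)"
    using assms by (intro divide_right_mono) auto
  also have "\<dots> = (B + V * (b - G)) / \<delta> + L / (2 * \<delta>) / K"
    using assms(1,2) by (simp add: field_simps)
  finally show ?thesis using assms(1,2) by simp
qed

context controlled_network
begin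

lemma queue_mean_nonneg:
  "0 \<le> expectation (\<lambda>\<omega>. Qp k \<omega> j)" "0 \<le> expectation (\<lambda>\<omega>. Qo k \<omega> j)"
  using queue_nonneg by (auto intro: integral_nonneg_AE)

lemma expected_drift:
  assumes sus: "sustainable x y \<delta>"
  shows "expectation (lyapunov (Suc k)) + 2 * \<delta> * backlog k
    \<le> expectation (lyapunov k) + 2 * (drift_bound - V * point_utility x y)
      + 2 * V * block_utility N (Ap k) (Ao k)"
proof -
  from sus obtain \<pi>p \<pi>o m where pol: "stationary_policy N \<pi>p \<pi>o m"
    and slack: "\<And>j. mean_service_p N \<pi>p m j \<ge> x j + \<delta>" "\<And>j. mean_service_o N \<pi>p \<pi>o m j \<ge> y j + \<delta>"
    and allowed: "\<And>j. allowed N j (x j, y j)"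
    unfolding sustainable_def by blast
  let ?G = "point_utility x y"
  let ?fp = "\<lambda>j \<omega>. policy_rate_p \<pi>p m j (channel_state N k \<omega>)"
  let ?fo = "\<lambda>j \<omega>. policy_rate_o \<pi>p \<pi>o m j (channel_state N k \<omega>)"
  let ?u = "\<lambda>\<omega>. point_utility (Ap k \<omega>) (Ao k \<omega>)"
  \<comment> \<open>The pathwise drift bound after the competitor has replaced the injections and
    services of the algorithm in the terms weighted by queues. Only the utility of the actual
    injections remains.\<close>
  let ?rhs = "\<lambda>\<omega>. lyapunov k \<omega> + 2 * (drift_bound - V * ?G) + 2 * V * ?u \<omega>
    + 2 * (\<Sum>j\<in>UNIV. Qp k \<omega> j * x j + Qo k \<omega> j * y j)
    - 2 * (\<Sum>j\<in>UNIV. Qp k \<omega> j * ?fp j \<omega> + Qo k \<omega> j * ?fo j \<omega>)"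
  note meas = policy_rate_measurable[OF pol] and bound = policy_rate_bounded[OF pol]
  note P = expectation_queue_channel(1,2)[OF meas(1) bound(1), unfolded policy_rate_mean]
  note O = expectation_queue_channel(3,4)[OF meas(2) bound(2), unfolded policy_rate_mean]
  note [simp] = queue_integrable P O block_utility_eq(2)[OF injections_admissible]
  have "expectation (lyapunov (Suc k)) \<le> expectation ?rhs"
  proof (rule integral_mono)
    fix \<omega> assume \<omega>: "\<omega> \<in> space M"
    from lyapunov_drift[OF \<omega>, of k] schedule_ge_policy[OF \<omega> pol, of k] flow_ge_point[OF \<omega> allowed, of k]
    show "lyapunov (Suc k) \<omega> \<le> ?rhs \<omega>" by argo
  qed simp_all
  also have "\<dots> = expectation (lyapunov k) + 2 * (drift_bound - V * ?G) + 2 * V * block_utility N (Ap k) (Ao k)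
    + 2 * (\<Sum>j\<in>UNIV. expectation (\<lambda>\<omega>. Qp k \<omega> j) * x j + expectation (\<lambda>\<omega>. Qo k \<omega> j) * y j)
    - 2 * (\<Sum>j\<in>UNIV. expectation (\<lambda>\<omega>. Qp k \<omega> j) * mean_service_p N \<pi>p m j
        + expectation (\<lambda>\<omega>. Qo k \<omega> j) * mean_service_o N \<pi>p \<pi>o m j)"
    by (simp add: block_utility_eq(1)[OF injections_admissible] prob_space)
  finally have "expectation (lyapunov (Suc k)) \<le> \<dots>" .
  moreover have "\<delta> * backlog k \<le> (\<Sum>j\<in>UNIV. expectation (\<lambda>\<omega>. Qp k \<omega> j) * mean_service_p N \<pi>p m j
        + expectation (\<lambda>\<omega>. Qo k \<omega> j) * mean_service_o N \<pi>p \<pi>o m j)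
      - (\<Sum>j\<in>UNIV. expectation (\<lambda>\<omega>. Qp k \<omega> j) * x j + expectation (\<lambda>\<omega>. Qo k \<omega> j) * y j)"
  proof -
    have "expectation (\<lambda>\<omega>. Qp k \<omega> j) * (x j + \<delta>) \<le> expectation (\<lambda>\<omega>. Qp k \<omega> j) * mean_service_p N \<pi>p m j"
      "expectation (\<lambda>\<omega>. Qo k \<omega> j) * (y j + \<delta>) \<le> expectation (\<lambda>\<omega>. Qo k \<omega> j) * mean_service_o N \<pi>p \<pi>o m j" for j
      by (intro mult_left_mono slack queue_mean_nonneg)+
    then have "(\<Sum>j\<in>UNIV. expectation (\<lambda>\<omega>. Qp k \<omega> j) * (x j + \<delta>) + expectation (\<lambda>\<omega>. Qo k \<omega> j) * (y j + \<delta>))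
      \<le> (\<Sum>j\<in>UNIV. expectation (\<lambda>\<omega>. Qp k \<omega> j) * mean_service_p N \<pi>p m j
        + expectation (\<lambda>\<omega>. Qo k \<omega> j) * mean_service_o N \<pi>p \<pi>o m j)"
      by (intro sum_mono add_mono)
    then show ?thesis
      by (simp add: sum.distrib sum_distrib_left algebra_simps)
  qed
  ultimately show ?thesis by argo
qed

lemma telescoped_drift:
  assumes sus: "sustainable x y \<delta>"
  shows "2 * \<delta> * (\<Sum>k<K. backlog k)
    \<le> expectation (lyapunov 0) + 2 * real K * (drift_bound - V * point_utility x y)
      + 2 * V * (\<Sum>k<K. block_utility N (Ap k) (Ao k))"
proof -
  have "expectation (lyapunov K) + 2 * \<delta> * (\<Sum>k<K. backlog k)
    \<le> expectation (lyapunov 0) + 2 * real K * (drift_bound - V * point_utility x y)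
      + 2 * V * (\<Sum>k<K. block_utility N (Ap k) (Ao k))"
  proof (induction K)
    case (Suc K)
    have "2 * real (Suc K) * (drift_bound - V * point_utility x y)
      = 2 * real K * (drift_bound - V * point_utility x y) + 2 * (drift_bound - V * point_utility x y)"
      by (simp add: algebra_simps)
    with Suc expected_drift[OF sus, of K] show ?case
      unfolding sum.lessThan_Suc distrib_left by linarith
  qed simp
  moreover have "0 \<le> expectation (lyapunov K)"
    by (intro integral_nonneg_AE AE_I2 sum_nonneg) simp
  ultimately show ?thesis by linarith
qed

text \<open>The nonnegative backlog is discarded, and with it the slack. The loss
  \<open>drift_bound / V\<close> is therefore the same for all sustainable points.\<close>

lemma utility_bound:
  assumes sus: "sustainable x y \<delta>"
  shows "ereal (point_utility x y - drift_bound / V)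
    \<le> liminf (\<lambda>K. ereal (1 / real K * (\<Sum>k<K. block_utility N (Ap k) (Ao k))))"
proof -
  let ?L = "expectation (lyapunov 0)" and ?a = "point_utility x y - drift_bound / V"
  have "(\<lambda>K. ?a - ?L / (2 * V) / real K) \<longlonglongrightarrow> ?a - 0"
    by (intro tendsto_diff tendsto_const lim_const_over_n)
  then have "ereal ?a = liminf (\<lambda>K. ereal (?a - ?L / (2 * V) / real K))"
    by (intro lim_imp_Liminf[symmetric]) simp_all
  also have "\<dots> \<le> liminf (\<lambda>K. ereal (1 / real K * (\<Sum>k<K. block_utility N (Ap k) (Ao k))))"
  proof (rule Liminf_mono)
    show "\<forall>\<^sub>F K in sequentially. ereal (?a - ?L / (2 * V) / real K)
        \<le> ereal (1 / real K * (\<Sum>k<K. block_utility N (Ap k) (Ao k)))"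
      using eventually_gt_at_top[of 0]
    proof eventually_elim
      case (elim K)
      have "0 \<le> 2 * \<delta> * (\<Sum>k<K. backlog k)"
        using sus by (intro mult_nonneg_nonneg sum_nonneg add_nonneg_nonneg queue_mean_nonneg)
          (auto simp: sustainable_def)
      with telescoped_drift[OF sus, of K]
      have "0 \<le> ?L + 2 * real K * (drift_bound - V * point_utility x y)
          + 2 * V * (\<Sum>k<K. block_utility N (Ap k) (Ao k))"
        by (rule order_trans[rotated])
      from utility_average_arith[OF _ V_pos this] elim show ?case by simp
    qed
  qed
  finally show ?thesis .
qed

text \<open>The converse trade: the backlog is kept and the utilities are bounded by
  \<open>b\<close>. \<open>S\<close> may be any part of the backlog, so private and open queues are
  treated alike.\<close>

lemma average_queue_bound:
  assumes sus: "sustainable x y \<delta>" and b: "\<And>a a'. admissible N a a' \<Longrightarrow> block_utility N a a' \<le> b"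
    and S: "\<And>k. S k \<le> backlog k"
  shows "limsup (\<lambda>K. ereal (1 / real K * (\<Sum>k<K. S k)))
    \<le> ereal ((drift_bound + V * (b - point_utility x y)) / \<delta>)"
proof -
  let ?L = "expectation (lyapunov 0)" and ?a = "(drift_bound + V * (b - point_utility x y)) / \<delta>"
  have \<delta>: "0 < \<delta>" using sus by (simp add: sustainable_def)
  have "limsup (\<lambda>K. ereal (1 / real K * (\<Sum>k<K. S k))) \<le> limsup (\<lambda>K. ereal (?a + ?L / (2 * \<delta>) / real K))"
  proof (rule Limsup_mono)
    show "\<forall>\<^sub>F K in sequentially. ereal (1 / real K * (\<Sum>k<K. S k)) \<le> ereal (?a + ?L / (2 * \<delta>) / real K)"
      using eventually_gt_at_top[of 0]
    proof eventually_elim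
      case (elim K)
      have "(\<Sum>k<K. block_utility N (Ap k) (Ao k)) \<le> (\<Sum>k<K. b)"
        by (intro sum_mono b injections_admissible)
      then have "2 * V * (\<Sum>k<K. block_utility N (Ap k) (Ao k)) \<le> 2 * V * (real K * b)"
        using V_pos by (intro mult_left_mono) auto
      moreover have "2 * \<delta> * (\<Sum>k<K. S k) \<le> 2 * \<delta> * (\<Sum>k<K. backlog k)"
        using \<delta> by (intro mult_left_mono sum_mono S) auto
      ultimately have "2 * \<delta> * (\<Sum>k<K. S k)
          \<le> ?L + 2 * real K * (drift_bound - V * point_utility x y) + 2 * V * (real K * b)"
        using telescoped_drift[OF sus, of K] by linarith
      from queue_average_arith[OF _ \<delta> this] elim show ?case by simp
    qed
  qed
  also have "\<dots> = ereal ?a"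
  proof (rule lim_imp_Limsup)
    have "(\<lambda>K. ?a + ?L / (2 * \<delta>) / real K) \<longlonglongrightarrow> ?a + 0"
      by (intro tendsto_add tendsto_const lim_const_over_n)
    then show "(\<lambda>K. ereal (?a + ?L / (2 * \<delta>) / real K)) \<longlonglongrightarrow> ereal ?a" by simp
  qed simp
  finally show ?thesis .
qed

end

section \<open>Sustainable points compared with the optimum\<close>

context wireless_network
begin

text \<open>Turns bounds that hold for every sustainable point into bounds on the optimum. It
  includes the infeasible case, where the supremum is over the empty set.\<close>

lemma g_star_le_utility:
  assumes "\<And>x y \<delta>. sustainable x y \<delta> \<Longrightarrow> ereal (point_utility x y) \<le> z"
  shows "g_star N \<le> z"
  unfolding g_star_def
proof (rule Sup_least, clarify)
  fix Bp Bo assume "feasible N Bp Bo"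
  then obtain x y \<delta> where "sustainable x y \<delta>" "average_utility N Bp Bo \<le> ereal (point_utility x y)"
    by (rule feasible_sustainable)
  then show "average_utility N Bp Bo \<le> z" using assms order_trans by blast
qed

lemma point_utility_le_g_bar:
  assumes "sustainable x y \<delta>"
  shows "ereal (point_utility x y) \<le> g_bar N"
proof -
  have "\<And>j. allowed N j (x j, y j)" using assms by (simp add: sustainable_def)
  note admissible_const[OF this]
  then show ?thesis unfolding g_bar_def by (intro Sup_upper) force
qed

text \<open>If the optimum is not attained, the gap of some sustainable point to \<open>g_bar\<close> is still at most
  a constant multiple of the gap of the optimum, and the constant is absorbed into \<open>\<epsilon>\<close>.\<close>

lemma sustainable_near_optimal:
  assumes nondeg: "nondegenerate N" and feas: "g_star N \<noteq> - \<infinity>"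
    and b: "g_bar N = ereal b" and g: "g_star N = ereal g"
  obtains x y \<delta> C where "sustainable x y \<delta>" "1 \<le> C" "b - point_utility x y \<le> C * (b - g)"
proof -
  have "g \<le> b" using g_star_le_utility[OF point_utility_le_g_bar] by (simp add: b g)
  show thesis
  proof (cases "\<exists>Bp Bo. feasible N Bp Bo \<and> average_utility N Bp Bo = g_star N")
    case True
    then obtain Bp Bo where "feasible N Bp Bo" and opt: "average_utility N Bp Bo = g_star N" by blast
    from this(1) obtain x y \<delta> where "sustainable x y \<delta>" "average_utility N Bp Bo \<le> ereal (point_utility x y)"
      by (rule feasible_sustainable)
    with opt \<open>g \<le> b\<close> show thesis by (intro that[of x y \<delta> 1]) (auto simp: g)
  next
    case False
    with nondeg have "g_star N < g_bar N" unfolding nondegenerate_def by blast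
    then have "g < b" by (simp add: b g)
    \<comment> \<open>Without any sustainable point the hypothesis of
      \<open>g_star_le_utility\<close> would hold vacuously for
      \<open>- \<infinity>\<close>.\<close>
    have "\<exists>x y \<delta>. sustainable x y \<delta>"
      using g_star_le_utility[of "- \<infinity>"] feas by auto
    then obtain x y \<delta> where sus: "sustainable x y \<delta>" by blast
    have "b - point_utility x y = (b - point_utility x y) / (b - g) * (b - g)"
      using \<open>g < b\<close> by simp
    \<comment> \<open>A factor of at least 1 can later be put in front of the drift constant as
      well.\<close>
    also have "\<dots> \<le> max 1 ((b - point_utility x y) / (b - g)) * (b - g)"
      using \<open>g < b\<close> by (intro mult_right_mono) auto
    finally show thesis using sus \<open>g \<le> b\<close> by (intro that[of x y \<delta> "max 1 ((b - point_utility x y) / (b - g))"]) auto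
  qed
qed

end

text \<open>Enlarging the drift constant by \<open>C\<close> too makes \<open>C\<close> a common
  factor of the numerator, so it can be moved into the denominator \<open>\<delta> / C\<close>. The
  constant \<open>B\<close> thus stays the one of the utility bound.\<close>

lemma (in controlled_network) performance_bounds:
  assumes C: "1 \<le> C" and sus: "sustainable x y \<delta>" and gap: "b - point_utility x y \<le> C * (b - g)"
    and b: "g_bar N = ereal b" "\<And>a a'. admissible N a a' \<Longrightarrow> block_utility N a a' \<le> b"
    and g: "g_star N = ereal g"
    and S: "\<And>k. S k \<le> backlog k"
  shows "limsup (\<lambda>K. ereal (1 / real K * (\<Sum>k<K. S k)))
    \<le> (ereal drift_bound + ereal V * (g_bar N - g_star N)) / ereal (\<delta> / C)"
proof -
  have \<delta>: "0 < \<delta>" using sus by (simp add: sustainable_def)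
  have "drift_bound + V * (b - point_utility x y) \<le> C * drift_bound + V * (C * (b - g))"
    using C gap V_pos drift_bound_pos
    by (intro add_mono mult_left_mono) (auto simp: mult_le_cancel_right1)
  also have "\<dots> = C * (drift_bound + V * (b - g))"
    by (simp add: algebra_simps)
  finally have "(drift_bound + V * (b - point_utility x y)) / \<delta> \<le> C * (drift_bound + V * (b - g)) / \<delta>"
    using \<delta> by (intro divide_right_mono) auto
  then have "ereal ((drift_bound + V * (b - point_utility x y)) / \<delta>)
      \<le> (ereal drift_bound + ereal V * (g_bar N - g_star N)) / ereal (\<delta> / C)"
    using \<delta> C by (simp add: b g mult.commute)
  with average_queue_bound[OF sus b(2) S] show ?thesis by (rule order_trans)
qed

theorem theorem5:
  fixes N :: "('w, 'n::finite) net"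
  assumes "network N"
    and "bounded_rates N"
    and "nondegenerate N"
  shows "\<exists>B \<epsilon>1 \<epsilon>2 :: real. B > 0 \<and> \<epsilon>1 > 0 \<and> \<epsilon>2 > 0 \<and>
    (\<forall>V>0. \<forall>Qp Qo Ap Ao Ip Io.
       runs_control_algorithm N V Qp Qo Ap Ao Ip Io \<longrightarrow>
         liminf (\<lambda>K. ereal (1 / real K *
             (\<Sum>k<K. \<Sum>j\<in>UNIV. exp_gp N (Ap k) j + exp_go N (Ap k) (Ao k) j)))
           \<ge> g_star N - ereal (B / V) \<and>
         limsup (\<lambda>K. ereal (1 / real K *
             (\<Sum>k<K. \<Sum>j\<in>UNIV. \<integral>\<omega>. Qp k \<omega> j \<partial>sample_space N)))
           \<le> (ereal B + ereal V * (g_bar N - g_star N)) / ereal \<epsilon>2 \<and>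
         limsup (\<lambda>K. ereal (1 / real K *
             (\<Sum>k<K. \<Sum>j\<in>UNIV. \<integral>\<omega>. Qo k \<omega> j \<partial>sample_space N)))
           \<le> (ereal B + ereal V * (g_bar N - g_star N)) / ereal \<epsilon>1)"
proof -
  obtain c where "\<And>k \<omega> j. \<omega> \<in> space (sample_space N) \<Longrightarrow> uplink N k \<omega> $ j \<le> c"
    using assms(2) by (auto simp: bounded_rates_def)
  with assms(1) interpret wireless_network N c by unfold_locales auto
  obtain b where b: "g_bar N = ereal b" "\<And>a a'. admissible N a a' \<Longrightarrow> block_utility N a a' \<le> b"
    by (rule g_bar_finite) blast
  have "g_star N \<le> ereal b"
    using g_star_le_utility[OF point_utility_le_g_bar] by (simp add: b)
  have utility: "g_star N - ereal (drift_bound / V) \<le> liminf (\<lambda>K. ereal (1 / real K *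
             (\<Sum>k<K. \<Sum>j\<in>UNIV. exp_gp N (Ap k) j + exp_go N (Ap k) (Ao k) j)))"
    if "0 < V" "runs_control_algorithm N V Qp Qo Ap Ao Ip Io" for V Qp Qo Ap Ao Ip Io
  proof -
    interpret controlled_network N c V Qp Qo Ap Ao Ip Io
      using that by unfold_locales
    let ?l = "liminf (\<lambda>K. ereal (1 / real K * (\<Sum>k<K. block_utility N (Ap k) (Ao k))))"
    \<comment> \<open>The supremum over sustainable points is taken only after the limit in time;
      moving \<open>drift_bound / V\<close> to the other side gives a bound that does not depend on
      the point.\<close>
    have "g_star N \<le> ?l + ereal (drift_bound / V)"
    proof (rule g_star_le_utility)
      fix x y \<delta> assume "sustainable x y \<delta>"
      from utility_bound[OF this] show "ereal (point_utility x y) \<le> ?l + ereal (drift_bound / V)"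
        by (simp add: ereal_minus_le flip: ereal_minus(1))
    qed
    then show ?thesis
      by (simp add: ereal_minus_le block_utility_def)
  qed
  show ?thesis
  proof (cases "g_star N")
    case (real g)
    then have "g_star N \<noteq> - \<infinity>" by simp
    \<comment> \<open>The point, its slack and \<open>C\<close> depend on the network alone. Being
      chosen before \<open>V\<close> and the run, they give denominators independent of
      \<open>V\<close>.\<close>
    obtain x y \<delta> C where sus: "sustainable x y \<delta>" and C: "1 \<le> C" "b - point_utility x y \<le> C * (b - g)"
      by (rule sustainable_near_optimal[OF assms(3) \<open>g_star N \<noteq> - \<infinity>\<close> b(1) real])
    have queue: "limsup (\<lambda>K. ereal (1 / real K * (\<Sum>k<K. \<Sum>j\<in>UNIV. \<integral>\<omega>. Qp k \<omega> j \<partial>sample_space N)))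
           \<le> (ereal drift_bound + ereal V * (g_bar N - g_star N)) / ereal (\<delta> / C)"
       "limsup (\<lambda>K. ereal (1 / real K * (\<Sum>k<K. \<Sum>j\<in>UNIV. \<integral>\<omega>. Qo k \<omega> j \<partial>sample_space N)))
           \<le> (ereal drift_bound + ereal V * (g_bar N - g_star N)) / ereal (\<delta> / C)"
      if "0 < V" "runs_control_algorithm N V Qp Qo Ap Ao Ip Io" for V Qp Qo Ap Ao Ip Io
    proof -
      interpret controlled_network N c V Qp Qo Ap Ao Ip Io
        using that by unfold_locales
      note bound = performance_bounds[OF C(1) sus C(2) b real]
      show "limsup (\<lambda>K. ereal (1 / real K * (\<Sum>k<K. \<Sum>j\<in>UNIV. \<integral>\<omega>. Qp k \<omega> j \<partial>sample_space N)))
           \<le> (ereal drift_bound + ereal V * (g_bar N - g_star N)) / ereal (\<delta> / C)"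
        by (rule bound) (assumption, intro sum_mono, use queue_mean_nonneg in simp)
      show "limsup (\<lambda>K. ereal (1 / real K * (\<Sum>k<K. \<Sum>j\<in>UNIV. \<integral>\<omega>. Qo k \<omega> j \<partial>sample_space N)))
           \<le> (ereal drift_bound + ereal V * (g_bar N - g_star N)) / ereal (\<delta> / C)"
        by (rule bound) (assumption, intro sum_mono, use queue_mean_nonneg in simp)
    qed
    have "0 < \<delta> / C" using sus C(1) by (simp add: sustainable_def)
    then show ?thesis
      using drift_bound_pos utility queue
      by (intro exI[of _ drift_bound] exI[of _ "\<delta> / C"] conjI allI impI)
  next
    case PInf
    with \<open>g_star N \<le> ereal b\<close> show ?thesis by simp
  next
    case MInf
    \<comment> \<open>As \<open>g_bar\<close> is finite and \<open>g_star\<close> is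
      \<open>- \<infinity>\<close>, the right-hand sides of the queue bounds are infinite, and any
      positive denominator will do.\<close>
    then have "(ereal drift_bound + ereal V * (g_bar N - g_star N)) / ereal 1 = \<infinity>" if "0 < V" for V
      using that by (simp add: b)
    then show ?thesis
      using drift_bound_pos utility
      by (intro exI[of _ drift_bound] exI[of _ 1] conjI allI impI) simp_all
  qed
qed

end
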